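(* Let $x=e^{-w}$, $t=1+\sum_{\mu\ge1}\frac{\mu^\mu}{\mu!}x^\mu$, and for $m\ge0$ let $$S_m^H(t)=\sum_{2g-2+n=m-1}\frac{1}{n!}F^H_{g,n}(t,\dots,t).$$ Then for every $m\ge0$, $$\Big(e^{mw}\frac{d}{dw}e^{-mw}\Big)S^H_{m+1}=-\frac12\Big[\frac{d^2}{dw^2}S^H_m+\sum_{a+b=m+1}\frac{dS^H_a}{dw}\cdot\frac{dS^H_b}{dw}+\frac{d}{dw}S^H_m\Big],$$ where $a,b\ge0$ in the sum. Moreover, $S_m^H(t)$ is a polynomial in $t$ of degree $3m-3$ for every $m\ge2$, and $S_m^H(1)=0$ for all $m\ge0$.
   Context: For $g\ge0$, $n\ge1$, $\mu\in\mathbb{Z}_{>0}^n$, $d=|\mu|$, $r=2g-2+n+d$: $h_{g,\mu}$ is $\frac1{d!}$ times the number of $r$-tuples of transpositions in $S_d$ generating a transitive subgroup whose product has cycle type $\mu$, and $H_{g,n}(\mu)=\frac{|\mathrm{Aut}(\mu)|}{r!}h_{g,\mu}$ (single Hurwitz numbers with labeled poles). $F^H_{g,n}(t_1,\dots,t_n)=\sum_{\mu\in\mathbb{Z}_{>0}^n}H_{g,n}(\mu)\prod_i x_i^{\mu_i}$, regarded as a function of $t_i$ via $x_i=z_ie^{-z_i}$, $z_i=(t_i-1)/t_i$; in particular $F^H_{g,n}(t,\dots,t)=\sum_\mu H_{g,n}(\mu)x^{|\mu|}$. The $w$-derivative acts through $t=t(w)$, with $-\frac{d}{dw}=x\frac{d}{dx}=t^2(t-1)\frac{d}{dt}$.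 *)

theory Defs
  imports Complex_Main
    "HOL-Library.Multiset"
    "HOL-Combinatorics.Permutations"
    "HOL-Combinatorics.Transposition"
    "HOL-Computational_Algebra.Polynomial"
    "HOL-Computational_Algebra.Formal_Power_Series"
begin

text \<open>Permutations of S_d are functions on nat permuting {..<d}.
  A transposition of S_d swaps two distinct points a, b < d.\<close>
definition is_transp :: "nat \<Rightarrow> (nat \<Rightarrow> nat) \<Rightarrow> bool" where
  "is_transp d s \<longleftrightarrow> (\<exists>a b. a < d \<and> b < d \<and> a \<noteq> b \<and> s = transpose a b)"

definition perm_prod :: "(nat \<Rightarrow> nat) list \<Rightarrow> nat \<Rightarrow> nat" where
  "perm_prod ts = foldr (\<circ>) ts id"

text \<open>The subgroup generated by the entries of ts (in a finite group, the
  generated monoid equals the generated subgroup) acts transitively on {..<d}.\<close>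
definition transitive_gen :: "nat \<Rightarrow> (nat \<Rightarrow> nat) list \<Rightarrow> bool" where
  "transitive_gen d ts \<longleftrightarrow>
     (\<forall>i<d. \<forall>j<d. \<exists>ws \<in> lists (set ts). perm_prod ws i = j)"

definition cycle_type :: "nat \<Rightarrow> (nat \<Rightarrow> nat) \<Rightarrow> nat multiset" where
  "cycle_type d p = image_mset card (mset_set ((\<lambda>i. range (\<lambda>k. (p ^^ k) i)) ` {..<d}))"

definition hurwitz_h :: "nat \<Rightarrow> nat list \<Rightarrow> real" where
  "hurwitz_h g \<mu> =
     (let n = length \<mu>; d = sum_list \<mu>; r = 2 * g + n + d - 2 in
      real (card {ts. length ts = r \<and> (\<forall>s\<in>set ts. is_transp d s) \<and> transitive_gen d ts
                      \<and> cycle_type d (perm_prod ts) = mset \<mu>}) / fact d)"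

definition aut_card :: "nat list \<Rightarrow> nat" where
  "aut_card \<mu> = card {\<sigma>. \<sigma> permutes {..<length \<mu>} \<and> (\<forall>i<length \<mu>. \<mu> ! (\<sigma> i) = \<mu> ! i)}"

definition hurwitz_H :: "nat \<Rightarrow> nat list \<Rightarrow> real" where
  "hurwitz_H g \<mu> =
     (let n = length \<mu>; d = sum_list \<mu>; r = 2 * g + n + d - 2 in
      real (aut_card \<mu>) / fact r * hurwitz_h g \<mu>)"

text \<open>F^H_{g,n}(t,...,t) as a formal power series in x.\<close>
definition F_diag :: "nat \<Rightarrow> nat \<Rightarrow> real fps" where
  "F_diag g n = Abs_fps (\<lambda>d. \<Sum>\<mu>\<in>{\<mu>. length \<mu> = n \<and> (\<forall>k\<in>set \<mu>. 0 < k) \<and> sum_list \<mu> = d}.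
                               hurwitz_H g \<mu>)"

definition S_H :: "nat \<Rightarrow> real fps" where
  "S_H m = (\<Sum>(g, n)\<in>{(g, n). 1 \<le> n \<and> 2 * g + n = m + 1}. fps_const (1 / fact n) * F_diag g n)"

definition t_ser :: "real fps" where
  "t_ser = 1 + Abs_fps (\<lambda>k. if k = 0 then 0 else real k ^ k / fact k)"

text \<open>d/dw = - x d/dx (since x = e^{-w}).\<close>
definition Dw :: "real fps \<Rightarrow> real fps" where
  "Dw f = - (fps_X * fps_deriv f)"

end

theory Submission
  imports Defs "HOL-Combinatorics.Cycles"
begin

text \<open>
  Summed over all cycle types, the Hurwitz numbers count connected labelled multigraphs: by the
  Riemann-Hurwitz relation every transitive \<open>(d + m - 1)\<close>-tuple of transpositions in \<open>S_d\<close> has a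
  product with \<open>n\<close> cycles, \<open>n = m + 1 - 2 g\<close> for a genus \<open>g \<ge> 0\<close>, and the factor \<open>|Aut \<mu>| / n!\<close>
  turns labelled poles into unlabelled ones. Hence \<open>[x^d] S_m = [y^(d + m - 1)] C_d(y)\<close>, where \<open>C_d\<close> is
  the exponential generating function of connected \<open>r\<close>-tuples on \<open>d\<close> points divided by \<open>d!\<close>.
  Removing one transposition either keeps the graph connected or splits it into two components, so
  \<open>C_d' = (d choose 2) C_d + 1/2 \<Sum> i j C_i C_j\<close> over \<open>i + j = d\<close>; its coefficients are the
  recursion for \<open>S_m\<close>.

  For polynomiality, replace \<open>C_d\<close> by \<open>exp (d y / 2) C_d\<close>, which turns \<open>d (d - 1) / 2\<close> into
  \<open>d^2 / 2\<close>. With \<open>D = x d/dx = t^2 (t - 1) d/dt\<close> the resulting series \<open>T_m\<close> satisfy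
  \<open>m T_(m+1) + (1/t) D T_(m+1) = R_m\<close> with \<open>R_m\<close> a polynomial in the earlier \<open>D T_a\<close>. Inductively
  \<open>t^a\<close> divides \<open>D T_a\<close>, so \<open>R_m = t^(m+1) Q\<close>, and with \<open>T_(m+1) = t^m q\<close> the equation becomes
  \<open>m q + (t - 1) q' = Q\<close>, which is diagonal in powers of \<open>t - 1\<close>. Positivity of leading coefficients
  fixes the degrees, and \<open>S_m = \<Sum>_j (-D/2)^j / j! T_(m-j)\<close> carries the result back.
\<close>

unbundle fps_syntax

section \<open>Connected tuples of transpositions\<close>

definition transps :: "nat set \<Rightarrow> (nat \<Rightarrow> nat) set" where
  "transps A = {transpose a b | a b. a \<in> A \<and> b \<in> A \<and> a \<noteq> b}"

text \<open>All points \<open>i\<close> are allowed, so a transposition also gives loops at its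
  fixed points; these do not affect reachability, and the relation needs no ground set.\<close>

definition edge :: "(nat \<Rightarrow> nat) set \<Rightarrow> (nat \<times> nat) set" where
  "edge X = {(i, s i) | i s. s \<in> X}"

definition conn :: "nat set \<Rightarrow> (nat \<Rightarrow> nat) set \<Rightarrow> bool" where
  "conn A X \<longleftrightarrow> (\<forall>i\<in>A. \<forall>j\<in>A. (i, j) \<in> (edge X)\<^sup>*)"

definition conn_lists :: "nat set \<Rightarrow> nat \<Rightarrow> (nat \<Rightarrow> nat) list set" where
  "conn_lists A r = {ts. length ts = r \<and> set ts \<subseteq> transps A \<and> conn A (set ts)}"

lemma is_transp_iff: "is_transp d s \<longleftrightarrow> s \<in> transps {..<d}"
  by (auto simp: is_transp_def transps_def)

lemma finite_transps [simp]: "finite A \<Longrightarrow> finite (transps A)"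
  by (rule finite_subset[of _ "case_prod transpose ` (A \<times> A)"]) (auto simp: transps_def)

lemma finite_conn_lists [simp]: "finite A \<Longrightarrow> finite (conn_lists A r)"
  by (rule finite_subset[OF _ finite_lists_length_eq[of "transps A" r]]) (auto simp: conn_lists_def)

lemma transps_mono: "A \<subseteq> B \<Longrightarrow> transps A \<subseteq> transps B"
  by (auto simp: transps_def)

lemma transps_outside: "s \<in> transps A \<Longrightarrow> i \<notin> A \<Longrightarrow> s i = i"
  by (auto simp: transps_def transpose_def)

lemma transps_inside: "s \<in> transps A \<Longrightarrow> i \<in> A \<Longrightarrow> s i \<in> A"
  by (auto simp: transps_def transpose_def)

lemma transps_involution: "s \<in> transps A \<Longrightarrow> s (s i) = i"
  by (auto simp: transps_def)

lemma transps_disjoint: "A \<inter> B = {} \<Longrightarrow> transps A \<inter> transps B = {}"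
  by (auto simp: transps_def transpose_eq_iff)
     (metis disjoint_iff transpose_apply_first transpose_apply_other)

lemma edgeI: "s \<in> X \<Longrightarrow> (i, s i) \<in> edge X"
  by (auto simp: edge_def)

lemma edge_mono: "X \<subseteq> Y \<Longrightarrow> edge X \<subseteq> edge Y"
  by (auto simp: edge_def)

lemma sym_edge: "X \<subseteq> transps A \<Longrightarrow> sym (edge X)"
  by (auto simp: sym_def edge_def) (metis subsetD transps_involution)

lemma perm_prod_simps [simp]:
  "perm_prod [] = id" "perm_prod (s # ts) = s \<circ> perm_prod ts"
  by (simp_all add: perm_prod_def)

text \<open>A path read step by step is a word in \<open>X\<close>. The head of a word acts last, so
  prolonging a path at its end prepends a letter.\<close>

lemma perm_prod_reach: "(\<exists>ws\<in>lists X. perm_prod ws i = j) \<longleftrightarrow> (i, j) \<in> (edge X)\<^sup>*"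
proof
  assume "\<exists>ws\<in>lists X. perm_prod ws i = j"
  then obtain ws where "ws \<in> lists X" "perm_prod ws i = j" by blast
  then show "(i, j) \<in> (edge X)\<^sup>*"
    by (induction ws arbitrary: j) (auto intro: rtrancl_into_rtrancl edgeI)
next
  assume "(i, j) \<in> (edge X)\<^sup>*"
  then show "\<exists>ws\<in>lists X. perm_prod ws i = j"
  proof induction
    case base
    show ?case by (rule bexI[of _ "[]"]) auto
  next
    case (step y z)
    then obtain ws s where "ws \<in> lists X" "perm_prod ws i = y" "s \<in> X" "z = s y"
      by (auto simp: edge_def)
    then show ?case by (intro bexI[of _ "s # ws"]) auto
  qed
qed

lemma transitive_gen_iff: "transitive_gen d ts \<longleftrightarrow> conn {..<d} (set ts)"
  by (simp add: transitive_gen_def conn_def perm_prod_reach Ball_def)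

section \<open>Splitting into two components\<close>

lemma rtrancl_edge_closed:
  assumes "(i, j) \<in> (edge X)\<^sup>*" "i \<in> B" "\<And>s k. s \<in> X \<Longrightarrow> k \<in> B \<Longrightarrow> s k \<in> B"
  shows "j \<in> B"
  using assms(1) by induction (use assms(2,3) in \<open>auto simp: edge_def\<close>)

text \<open>For nonempty \<open>B\<close> and \<open>A - B\<close> these are exactly the two
  components of \<open>X\<close>. This is the situation in which one more transposition turns a
  disconnected set into a connected one.\<close>

definition split_at :: "nat set \<Rightarrow> nat set \<Rightarrow> (nat \<Rightarrow> nat) set \<Rightarrow> bool" where
  "split_at A B X \<longleftrightarrow> X \<subseteq> transps B \<union> transps (A - B)
     \<and> conn B (X \<inter> transps B) \<and> conn (A - B) (X \<inter> transps (A - B))"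

lemma split_at_closed:
  assumes "split_at A B X" "s \<in> X" "k \<in> B"
  shows "s k \<in> B"
  using assms transps_inside[of s B k] transps_outside[of s "A - B" k] unfolding split_at_def by auto

text \<open>Recovering \<open>B\<close> as the component of \<open>a\<close> makes the families
  belonging to different \<open>B\<close> disjoint, which the count below needs.\<close>

lemma split_at_unique:
  assumes "split_at A B X" "a \<in> B"
  shows "B = (edge X)\<^sup>* `` {a}"
proof
  show "B \<subseteq> (edge X)\<^sup>* `` {a}"
    using assms rtrancl_mono[OF edge_mono[of "X \<inter> transps B" X]]
    by (auto simp: split_at_def conn_def)
  show "(edge X)\<^sup>* `` {a} \<subseteq> B"
    using rtrancl_edge_closed[of a _ X B] split_at_closed[OF assms(1)] assms(2) by auto
qed

lemma split_at_imp_conn_insert: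
  assumes "split_at A B X" "X \<subseteq> transps A" "a \<in> B" "b \<in> A - B" "B \<subseteq> A"
  shows "conn A (insert (transpose a b) X)"
proof -
  let ?Y = "insert (transpose a b) X"
  have Y: "?Y \<subseteq> transps A" using assms by (auto simp: transps_def)
  have sym: "sym ((edge ?Y)\<^sup>*)" by (intro sym_rtrancl sym_edge[OF Y])
  have ab: "(a, b) \<in> (edge ?Y)\<^sup>*" using edgeI[of "transpose a b" ?Y a] by auto
  have "(a, i) \<in> (edge ?Y)\<^sup>*" if "i \<in> A" for i
  proof (cases "i \<in> B")
    case True
    then have "(a, i) \<in> (edge (X \<inter> transps B))\<^sup>*"
      using assms by (auto simp: split_at_def conn_def)
    then show ?thesis using rtrancl_mono[OF edge_mono[of "X \<inter> transps B" ?Y]] by auto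
  next
    case False
    then have "(b, i) \<in> (edge (X \<inter> transps (A - B)))\<^sup>*"
      using assms that by (auto simp: split_at_def conn_def)
    then have "(b, i) \<in> (edge ?Y)\<^sup>*"
      using rtrancl_mono[OF edge_mono[of "X \<inter> transps (A - B)" ?Y]] by auto
    with ab show ?thesis by (rule rtrancl_trans)
  qed
  with sym show ?thesis unfolding conn_def by (meson symD rtrancl_trans)
qed

lemma split_at_not_conn:
  assumes "split_at A B X" "a \<in> B" "b \<in> A - B" "B \<subseteq> A"
  shows "\<not> conn A X"
  using split_at_unique[OF assms(1,2)] assms(2-) unfolding conn_def by blast

text \<open>A single new edge can only merge the components of \<open>a\<close> and
  \<open>b\<close>. If the result is connected and \<open>X\<close> is not, these two components are
  distinct and exhaust \<open>A\<close>.\<close>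

lemma split_at_exists:
  assumes X: "X \<subseteq> transps A" and ab: "a \<in> A" "b \<in> A" "a \<noteq> b"
    and c: "conn A (insert (transpose a b) X)" and nc: "\<not> conn A X"
  shows "\<exists>B. B \<subseteq> A \<and> a \<in> B \<and> b \<in> A - B \<and> split_at A B X"
proof -
  define B where "B = (edge X)\<^sup>* `` {a}"
  have sym: "sym ((edge X)\<^sup>*)" by (intro sym_rtrancl sym_edge[OF X])
  have aB: "a \<in> B" by (auto simp: B_def)
  have BA: "B \<subseteq> A"
  proof
    fix i assume "i \<in> B"
    then have "(a, i) \<in> (edge X)\<^sup>*" by (simp add: B_def)
    then show "i \<in> A" by (rule rtrancl_edge_closed) (use X ab transps_inside in blast)+
  qed
  have Bcl: "s k \<in> B \<longleftrightarrow> k \<in> B" if "s \<in> X" for s k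
  proof -
    have "s k \<in> B" if "k \<in> B" for k
      using that edgeI[OF \<open>s \<in> X\<close>, of k] by (auto simp: B_def intro: rtrancl_into_rtrancl)
    moreover have "s (s k) = k" using X \<open>s \<in> X\<close> transps_involution by blast
    ultimately show ?thesis by metis
  qed
  have bB: "b \<notin> B"
  proof
    assume "b \<in> B"
    then have E: "(a, b) \<in> (edge X)\<^sup>*" "(b, a) \<in> (edge X)\<^sup>*" using sym by (auto simp: B_def dest: symD)
    \<comment> \<open>If \<open>a\<close> and \<open>b\<close> already lay in one component, the new
      edge would not enlarge the reachability relation.\<close>
    have "edge (insert (transpose a b) X) \<subseteq> (edge X)\<^sup>*"
      using E by (auto simp: edge_def transpose_def)
    then have "(edge (insert (transpose a b) X))\<^sup>* \<subseteq> (edge X)\<^sup>*"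
      by (metis rtrancl_idemp rtrancl_mono)
    with c nc show False by (auto simp: conn_def)
  qed
  have sub: "X \<subseteq> transps B \<union> transps (A - B)"
  proof
    fix s assume s: "s \<in> X"
    then obtain p q where pq: "s = transpose p q" "p \<in> A" "q \<in> A" "p \<noteq> q"
      using X by (auto simp: transps_def)
    have "q \<in> B \<longleftrightarrow> p \<in> B" using Bcl[OF s, of p] pq by simp
    then show "s \<in> transps B \<union> transps (A - B)" using pq by (auto simp: transps_def)
  qed
  have connB: "conn B (X \<inter> transps B)"
  proof -
    have *: "(a, i) \<in> (edge (X \<inter> transps B))\<^sup>*" if "(a, i) \<in> (edge X)\<^sup>*" for i
      using that
    proof induction
      case (step y z)
      then obtain s where s: "s \<in> X" "z = s y" by (auto simp: edge_def)
      have yB: "y \<in> B" using step by (auto simp: B_def)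
      show ?case
      proof (cases "s \<in> transps B")
        case True
        then have "(y, z) \<in> edge (X \<inter> transps B)" using s edgeI by auto
        then show ?thesis using step by (meson rtrancl_into_rtrancl)
      next
        case False
        then have "s \<in> transps (A - B)" using sub s by auto
        then have "z = y" using s yB transps_outside by auto
        then show ?thesis using step by simp
      qed
    qed auto
    have "sym ((edge (X \<inter> transps B))\<^sup>*)" by (intro sym_rtrancl sym_edge[of _ A]) (use X in auto)
    with * show ?thesis unfolding conn_def B_def by (meson Image_singleton_iff symD rtrancl_trans)
  qed
  have connAB: "conn (A - B) (X \<inter> transps (A - B))"
  proof -
    let ?E = "edge (X \<inter> transps (A - B))"
    \<comment> \<open>Invariant along a path from \<open>b\<close>: only the new edge leads from
      \<open>B\<close> to its complement, and it re-enters at \<open>b\<close>, so every visited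
      point outside \<open>B\<close> is reachable from \<open>b\<close> inside the
      complement.\<close>
    have *: "i \<in> B \<or> (b, i) \<in> ?E\<^sup>*" if "(b, i) \<in> (edge (insert (transpose a b) X))\<^sup>*" for i
      using that
    proof induction
      case (step y z)
      then obtain s where s: "s = transpose a b \<or> s \<in> X" "z = s y" by (auto simp: edge_def)
      show ?case
      proof (cases "s \<in> X")
        case False
        then have "z = (if y = a then b else if y = b then a else y)" using s by (auto simp: transpose_def)
        then show ?thesis using step aB by auto
      next
        case True
        show ?thesis
        proof (cases "y \<in> B")
          case True
          then show ?thesis using Bcl[OF \<open>s \<in> X\<close>] s by auto
        next
          case False
          then have bY: "(b, y) \<in> ?E\<^sup>*" using step by auto
          show ?thesis
          proof (cases "s \<in> transps (A - B)")
            case True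
            then have "(y, z) \<in> ?E" using s \<open>s \<in> X\<close> edgeI by auto
            then show ?thesis using bY by (meson rtrancl_into_rtrancl)
          next
            case False
            then have "z = y" using sub \<open>s \<in> X\<close> s \<open>y \<notin> B\<close> transps_outside by auto
            then show ?thesis using bY by simp
          qed
        qed
      qed
    qed auto
    have "sym (?E\<^sup>*)" by (intro sym_rtrancl sym_edge[of _ A]) (use X in auto)
    moreover have "(b, i) \<in> ?E\<^sup>*" if "i \<in> A - B" for i
      using * c that ab by (auto simp: conn_def)
    ultimately show ?thesis unfolding conn_def by (meson symD rtrancl_trans)
  qed
  show ?thesis using BA aB bB ab sub connB connAB by (auto simp: split_at_def)
qed

text \<open>Lists splitting along \<open>B\<close> are the shuffles of a connected list on \<open>B\<close> with one on the complement.\<close>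

lemma card_split_lists:
  assumes "finite A" "B \<subseteq> A"
  shows "card {ts. length ts = r \<and> set ts \<subseteq> transps A \<and> split_at A B (set ts)} =
    (\<Sum>k\<le>r. (r choose k) * card (conn_lists B k) * card (conn_lists (A - B) (r - k)))"
proof -
  define M where "M = {ts. length ts = r \<and> set ts \<subseteq> transps A \<and> split_at A B (set ts)}"
  define P where "P = (SIGMA k:{..r}. conn_lists B k \<times> conn_lists (A - B) (r - k))"
  have disj: "transps B \<inter> transps (A - B) = {}" by (rule transps_disjoint) auto
  have fin: "finite P" unfolding P_def
    using assms finite_subset by (intro finite_SigmaI finite_cartesian_product finite_conn_lists) auto
  \<comment> \<open>The two filters recover both parts of a shuffle, so the shuffle sets of distinct
    triples in \<open>P\<close> are disjoint.\<close>
  have fl: "filter (\<lambda>s. s \<in> transps B) ts = us" "filter (\<lambda>s. s \<notin> transps B) ts = vs"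
    if "ts \<in> shuffles us vs" "set us \<subseteq> transps B" "set vs \<subseteq> transps (A - B)" for ts us vs
  proof -
    have "set us \<inter> set vs = {}" using that disj by auto
    note F = filter_shuffles_disjoint1[OF this that(1)]
    have st: "set ts = set us \<union> set vs" using set_shuffles[OF that(1)] .
    have "filter (\<lambda>s. s \<in> transps B) ts = filter (\<lambda>s. s \<in> set us) ts"
      using st that disj by (intro filter_cong) auto
    then show "filter (\<lambda>s. s \<in> transps B) ts = us" using F by simp
    have "filter (\<lambda>s. s \<notin> transps B) ts = filter (\<lambda>s. s \<notin> set us) ts"
      using st that disj by (intro filter_cong) auto
    then show "filter (\<lambda>s. s \<notin> transps B) ts = vs" using F by simp
  qed
  have "M = (\<Union>(k, us, vs)\<in>P. shuffles us vs)"
  proof (intro set_eqI iffI)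
    fix ts assume ts: "ts \<in> M"
    let ?us = "filter (\<lambda>s. s \<in> transps B) ts" and ?vs = "filter (\<lambda>s. s \<notin> transps B) ts"
    have sub: "set ts \<subseteq> transps B \<union> transps (A - B)" using ts by (auto simp: M_def split_at_def)
    have l: "length ?us + length ?vs = r" using ts sum_length_filter_compl[of "\<lambda>s. s \<in> transps B" ts]
      by (simp add: M_def)
    have s1: "set ?us = set ts \<inter> transps B" by auto
    have s2: "set ?vs = set ts \<inter> transps (A - B)" using sub disj by auto
    have "(length ?us, ?us, ?vs) \<in> P"
      using ts l s1 s2 by (auto simp: P_def conn_lists_def M_def split_at_def)
    with partition_in_shuffles[of ts "\<lambda>s. s \<in> transps B"]
    show "ts \<in> (\<Union>(k, us, vs)\<in>P. shuffles us vs)" by blast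
  next
    fix ts assume "ts \<in> (\<Union>(k, us, vs)\<in>P. shuffles us vs)"
    then obtain k us vs where p: "(k, us, vs) \<in> P" and sh: "ts \<in> shuffles us vs" by blast
    have st: "set ts = set us \<union> set vs" using set_shuffles[OF sh] .
    have u: "set us \<subseteq> transps B" "set vs \<subseteq> transps (A - B)" using p by (auto simp: P_def conn_lists_def)
    have "set ts \<inter> transps B = set us" "set ts \<inter> transps (A - B) = set vs"
      using st u disj by auto
    then show "ts \<in> M"
      using p st u length_shuffles[OF sh] transps_mono[OF assms(2)] transps_mono[of "A - B" A]
      by (auto simp: M_def split_at_def P_def conn_lists_def)
  qed
  then have "card M = (\<Sum>(k, us, vs)\<in>P. card (shuffles us vs))"
    using fin
  proof (simp only:, subst card_UN_disjoint)
    show "\<forall>i\<in>P. \<forall>j\<in>P. i \<noteq> j \<longrightarrow>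
       (case i of (k, us, vs) \<Rightarrow> shuffles us vs) \<inter> (case j of (k, us, vs) \<Rightarrow> shuffles us vs) = {}"
    proof (intro ballI impI, rule ccontr)
      fix x y assume xy: "x \<in> P" "y \<in> P" "x \<noteq> y"
        and ne: "(case x of (k, us, vs) \<Rightarrow> shuffles us vs) \<inter> (case y of (k, us, vs) \<Rightarrow> shuffles us vs) \<noteq> {}"
      obtain k us vs k' us' vs' where x: "x = (k, us, vs)" "y = (k', us', vs')" by (metis prod_cases3)
      note p = xy[unfolded x]
      from ne x obtain ts where "ts \<in> shuffles us vs" "ts \<in> shuffles us' vs'" by auto
      then have "us = us'" "vs = vs'"
        using fl[of ts us vs] fl[of ts us' vs'] p by (auto simp: P_def conn_lists_def)
      then show False using p by (auto simp: P_def conn_lists_def)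
    qed
  qed (auto intro!: sum.cong)
  also have "\<dots> = (\<Sum>(k, us, vs)\<in>P. r choose k)"
  proof (rule sum.cong[OF refl], clarify)
    fix k us vs assume p: "(k, us, vs) \<in> P"
    then have "set us \<inter> set vs = {}" "length us = k" "length vs = r - k" "k \<le> r"
      using disj by (auto simp: P_def conn_lists_def)
    then show "card (shuffles us vs) = r choose k" by (simp add: card_disjoint_shuffles)
  qed
  also have "\<dots> = (\<Sum>k\<le>r. \<Sum>p\<in>conn_lists B k \<times> conn_lists (A - B) (r - k). r choose k)"
    unfolding P_def using assms finite_subset[OF assms(2,1)]
    by (subst sum.Sigma[symmetric]) (auto intro!: sum.cong simp: split_def)
  also have "\<dots> = (\<Sum>k\<le>r. (r choose k) * card (conn_lists B k) * card (conn_lists (A - B) (r - k)))"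
    by (auto intro!: sum.cong simp: card_cartesian_product)
  finally show ?thesis by (simp add: M_def)
qed

section \<open>Recursion for the number of connected tuples\<close>

lemma card_transps_pairs:
  assumes "e \<in> transps A"
  shows "card {(a, b). a \<in> A \<and> b \<in> A \<and> a \<noteq> b \<and> transpose a b = e} = 2"
proof -
  obtain p q where pq: "e = transpose p q" "p \<in> A" "q \<in> A" "p \<noteq> q"
    using assms by (auto simp: transps_def)
  have "a = p \<and> b = q \<or> a = q \<and> b = p" if "a \<noteq> b" "transpose a b = transpose p q" for a b
    using that pq(4) by (metis transpose_apply_first transpose_apply_second transpose_apply_other)
  then have "{(a, b). a \<in> A \<and> b \<in> A \<and> a \<noteq> b \<and> transpose a b = e} = {(p, q), (q, p)}"
    using pq by (auto simp: transpose_commute)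
  then show ?thesis using pq by simp
qed

lemma sum_transps_pairs:
  assumes "finite A"
  shows "2 * (\<Sum>e\<in>transps A. f e) = (\<Sum>(a, b)\<in>{(a, b). a \<in> A \<and> b \<in> A \<and> a \<noteq> b}. f (transpose a b) :: nat)"
proof -
  define P where "P = {(a, b). a \<in> A \<and> b \<in> A \<and> a \<noteq> b}"
  have fin: "finite P" unfolding P_def by (rule finite_subset[of _ "A \<times> A"]) (use assms in auto)
  have "(\<Sum>x\<in>P. f (case_prod transpose x)) =
      (\<Sum>e\<in>transps A. \<Sum>x\<in>{x \<in> P. case_prod transpose x = e}. f (case_prod transpose x))"
    using finite_transps[OF assms] fin by (intro sum.group[symmetric]) (auto simp: P_def transps_def)
  also have "\<dots> = (\<Sum>e\<in>transps A. 2 * f e)"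
  proof (rule sum.cong[OF refl])
    fix e assume e: "e \<in> transps A"
    have eq: "{x \<in> P. case_prod transpose x = e} = {(a, b). a \<in> A \<and> b \<in> A \<and> a \<noteq> b \<and> transpose a b = e}"
      by (auto simp: P_def)
    have "(\<Sum>x\<in>{x \<in> P. case_prod transpose x = e}. f (case_prod transpose x)) =
       (\<Sum>x\<in>{x \<in> P. case_prod transpose x = e}. f e)" by (rule sum.cong) auto
    also have "\<dots> = 2 * f e" using card_transps_pairs[OF e] by (simp add: eq)
    finally show "(\<Sum>x\<in>{x \<in> P. case_prod transpose x = e}. f (case_prod transpose x)) = 2 * f e" .
  qed
  finally show ?thesis by (simp add: P_def sum_distrib_left split_def)
qed

text \<open>Remove the first transposition. The remaining list is either connected, and then any
  transposition may be put back, or it splits along a unique \<open>B\<close> with \<open>a\<close>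
  in \<open>B\<close> and \<open>b\<close> outside. Summing over ordered pairs \<open>(a, b)\<close>
  causes the factor 2 and gives \<open>card B * card (A - B)\<close> pairs for each
  \<open>B\<close>.\<close>

lemma card_conn_lists_Suc:
  assumes fin: "finite A"
  shows "2 * card (conn_lists A (Suc r)) = card A * (card A - 1) * card (conn_lists A r)
    + (\<Sum>B\<in>Pow A. card B * card (A - B) *
        (\<Sum>k\<le>r. (r choose k) * card (conn_lists B k) * card (conn_lists (A - B) (r - k))))"
proof -
  define L where "L = {ts. length ts = r \<and> set ts \<subseteq> transps A}"
  define P where "P = {(a, b). a \<in> A \<and> b \<in> A \<and> a \<noteq> b}"
  define N where "N B = {ts \<in> L. split_at A B (set ts)}" for B
  have finL: "finite L"
    using finite_lists_length_eq[of "transps A" r] fin by (simp add: L_def conj_commute)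
  have finP: "finite P" unfolding P_def by (rule finite_subset[of _ "A \<times> A"]) (use fin in auto)
  have cardP: "card P = card A * (card A - 1)"
  proof -
    have "P = A \<times> A - (\<lambda>a. (a, a)) ` A" by (auto simp: P_def)
    moreover have "card (A \<times> A - (\<lambda>a. (a, a)) ` A) = card (A \<times> A) - card ((\<lambda>a. (a, a)) ` A)"
      using fin by (intro card_Diff_subset) auto
    ultimately have "card P = card (A \<times> A) - card ((\<lambda>a. (a, a)) ` A)" by simp
    also have "\<dots> = card A * card A - card A" by (simp add: card_cartesian_product card_image inj_on_def)
    finally show ?thesis by (simp add: algebra_simps)
  qed
  have "conn_lists A (Suc r) = (\<Union>e\<in>transps A. (#) e ` {ts \<in> L. conn A (insert e (set ts))})"
  proof (intro set_eqI iffI)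
    fix ts assume "ts \<in> conn_lists A (Suc r)"
    then show "ts \<in> (\<Union>e\<in>transps A. (#) e ` {ts \<in> L. conn A (insert e (set ts))})"
      by (cases ts) (auto simp: conn_lists_def L_def)
  qed (auto simp: conn_lists_def L_def)
  then have "card (conn_lists A (Suc r)) = (\<Sum>e\<in>transps A. card ((#) e ` {ts \<in> L. conn A (insert e (set ts))}))"
    by (simp only:, subst card_UN_disjoint) (use fin finL in auto)
  also have "\<dots> = (\<Sum>e\<in>transps A. card {ts \<in> L. conn A (insert e (set ts))})"
    by (simp add: card_image)
  finally have "2 * card (conn_lists A (Suc r)) =
      (\<Sum>(a, b)\<in>P. card {ts \<in> L. conn A (insert (transpose a b) (set ts))})"
    using sum_transps_pairs[OF fin, of "\<lambda>e. card {ts \<in> L. conn A (insert e (set ts))}"]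
    by (simp add: P_def)
  also have "\<dots> = (\<Sum>(a, b)\<in>P. card (conn_lists A r) + (\<Sum>B\<in>{B \<in> Pow A. a \<in> B \<and> b \<in> A - B}. card (N B)))"
  proof (rule sum.cong[OF refl], clarify)
    fix a b assume "(a, b) \<in> P"
    then have ab: "a \<in> A" "b \<in> A" "a \<noteq> b" by (auto simp: P_def)
    let ?S = "{B \<in> Pow A. a \<in> B \<and> b \<in> A - B}"
    have finS: "finite ?S" using fin by auto
    have "{ts \<in> L. conn A (insert (transpose a b) (set ts))} = conn_lists A r \<union> (\<Union>B\<in>?S. N B)"
    proof (intro set_eqI iffI)
      fix ts assume "ts \<in> {ts \<in> L. conn A (insert (transpose a b) (set ts))}"
      then show "ts \<in> conn_lists A r \<union> (\<Union>B\<in>?S. N B)"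
        using split_at_exists[of "set ts" A a b] ab
        by (cases "conn A (set ts)") (auto simp: conn_lists_def L_def N_def)
    next
      fix ts assume "ts \<in> conn_lists A r \<union> (\<Union>B\<in>?S. N B)"
      then show "ts \<in> {ts \<in> L. conn A (insert (transpose a b) (set ts))}"
      proof
        assume "ts \<in> conn_lists A r"
        then show ?thesis
          using rtrancl_mono[OF edge_mono[of "set ts" "insert (transpose a b) (set ts)"]]
          by (auto simp: conn_lists_def L_def conn_def)
      next
        assume "ts \<in> (\<Union>B\<in>?S. N B)"
        then show ?thesis using split_at_imp_conn_insert[of A _ "set ts" a b]
          by (auto simp: L_def N_def)
      qed
    qed
    moreover have "conn_lists A r \<inter> (\<Union>B\<in>?S. N B) = {}"
      using split_at_not_conn[of A _ _ a b] by (auto simp: conn_lists_def N_def)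
    moreover have "card (\<Union>B\<in>?S. N B) = (\<Sum>B\<in>?S. card (N B))"
    proof (rule card_UN_disjoint[OF finS])
      show "\<forall>i\<in>?S. finite (N i)" using finL by (auto simp: N_def)
      show "\<forall>i\<in>?S. \<forall>j\<in>?S. i \<noteq> j \<longrightarrow> N i \<inter> N j = {}"
      proof (clarify, rule ccontr)
        fix B C assume B: "a \<in> B" "a \<in> C" "B \<noteq> C" "N B \<inter> N C \<noteq> {}"
        then obtain ts where "split_at A B (set ts)" "split_at A C (set ts)" by (auto simp: N_def)
        then show False using split_at_unique[of A B "set ts" a] split_at_unique[of A C "set ts" a] B
          by simp
      qed
    qed
    ultimately show "card {ts \<in> L. conn A (insert (transpose a b) (set ts))} =
        card (conn_lists A r) + (\<Sum>B\<in>?S. card (N B))"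
      using fin finL finS by (simp add: card_Un_disjoint N_def)
  qed
  also have "\<dots> = card P * card (conn_lists A r) + (\<Sum>(a, b)\<in>P. \<Sum>B\<in>{B \<in> Pow A. a \<in> B \<and> b \<in> A - B}. card (N B))"
    by (simp add: split_def sum.distrib)
  also have "(\<Sum>(a, b)\<in>P. \<Sum>B\<in>{B \<in> Pow A. a \<in> B \<and> b \<in> A - B}. card (N B)) =
      (\<Sum>B\<in>Pow A. \<Sum>x\<in>{x \<in> P. fst x \<in> B \<and> snd x \<in> A - B}. card (N B))"
    unfolding split_def by (rule sum.swap_restrict) (use finP fin in auto)
  also have "\<dots> = (\<Sum>B\<in>Pow A. card B * card (A - B) * card (N B))"
  proof (rule sum.cong[OF refl])
    fix B assume "B \<in> Pow A"
    then have "{x \<in> P. fst x \<in> B \<and> snd x \<in> A - B} = B \<times> (A - B)" by (auto simp: P_def)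
    then show "(\<Sum>x\<in>{x \<in> P. fst x \<in> B \<and> snd x \<in> A - B}. card (N B)) = card B * card (A - B) * card (N B)"
      by (simp add: card_cartesian_product)
  qed
  also have "\<dots> = (\<Sum>B\<in>Pow A. card B * card (A - B) *
        (\<Sum>k\<le>r. (r choose k) * card (conn_lists B k) * card (conn_lists (A - B) (r - k))))"
    using card_split_lists[OF fin, of _ r] by (intro sum.cong) (auto simp: N_def L_def conj_assoc)
  finally show ?thesis by (simp add: cardP)
qed

lemma sum_Pow_card:
  fixes g :: "nat \<Rightarrow> nat"
  assumes "finite A"
  shows "(\<Sum>B\<in>Pow A. g (card B)) = (\<Sum>i\<le>card A. (card A choose i) * g i)"
proof -
  have "(\<Sum>B\<in>Pow A. g (card B)) = (\<Sum>i\<le>card A. \<Sum>B\<in>{B \<in> Pow A. card B = i}. g (card B))"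
    using assms by (intro sum.group[symmetric]) (auto intro: card_mono)
  also have "\<dots> = (\<Sum>i\<le>card A. (card A choose i) * g i)"
    using n_subsets[OF assms] by (intro sum.cong) (auto simp: Pow_def)
  finally show ?thesis .
qed

definition num_conn :: "nat \<Rightarrow> nat \<Rightarrow> nat" where
  "num_conn d r = card (conn_lists {..<d} r)"

lemma conn_lists_0: "finite A \<Longrightarrow> conn_lists A 0 = (if card A \<le> 1 then {[]} else {})"
proof -
  assume "finite A"
  have "conn A {} \<longleftrightarrow> (\<forall>i\<in>A. \<forall>j\<in>A. i = j)" by (auto simp: conn_def edge_def)
  also have "\<dots> \<longleftrightarrow> card A \<le> 1" using \<open>finite A\<close> by (simp add: card_le_Suc0_iff_eq)
  finally show ?thesis by (auto simp: conn_lists_def)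
qed

lemma num_conn_0: "num_conn d 0 = (if d \<le> 1 then 1 else 0)"
  by (simp add: num_conn_def conn_lists_0)

text \<open>Independence of the labels is assumed only for lists of length at most \<open>r\<close>,
  so that the recursion can serve as the induction step of the proof of that independence.\<close>

lemma card_conn_lists_rec:
  assumes fin: "finite A"
    and IH: "\<And>k B. k \<le> r \<Longrightarrow> finite B \<Longrightarrow> card (conn_lists B k) = num_conn (card B) k"
  shows "2 * card (conn_lists A (Suc r)) = card A * (card A - 1) * num_conn (card A) r
    + (\<Sum>i\<le>card A. (card A choose i) * (i * (card A - i) *
      (\<Sum>k\<le>r. (r choose k) * num_conn i k * num_conn (card A - i) (r - k))))"
proof -
  have "card B * card (A - B) *
      (\<Sum>k\<le>r. (r choose k) * card (conn_lists B k) * card (conn_lists (A - B) (r - k))) =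
    card B * (card A - card B) *
      (\<Sum>k\<le>r. (r choose k) * num_conn (card B) k * num_conn (card A - card B) (r - k))"
    if "B \<in> Pow A" for B
  proof -
    have B: "finite B" "B \<subseteq> A" using that fin finite_subset by auto
    then have "card (A - B) = card A - card B" by (simp add: card_Diff_subset)
    then show ?thesis using IH B fin by (auto intro!: sum.cong)
  qed
  then have "(\<Sum>B\<in>Pow A. card B * card (A - B) *
      (\<Sum>k\<le>r. (r choose k) * card (conn_lists B k) * card (conn_lists (A - B) (r - k)))) =
      (\<Sum>B\<in>Pow A. card B * (card A - card B) *
      (\<Sum>k\<le>r. (r choose k) * num_conn (card B) k * num_conn (card A - card B) (r - k)))"
    by (rule sum.cong[OF refl])
  then show ?thesis
    using card_conn_lists_Suc[OF fin, of r] IH[of r A] fin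
    by (simp add: sum_Pow_card[OF fin, where g = "\<lambda>i. i * (card A - i) *
          (\<Sum>k\<le>r. (r choose k) * num_conn i k * num_conn (card A - i) (r - k))"])
qed

text \<open>No relabelling bijection is constructed: the counts for \<open>A\<close> and for
  \<open>{..<card A}\<close> satisfy the same recursion with the same start.\<close>

lemma card_conn_lists: "finite A \<Longrightarrow> card (conn_lists A r) = num_conn (card A) r"
proof (induction r arbitrary: A rule: less_induct)
  case (less r)
  show ?case
  proof (cases r)
    case 0
    then show ?thesis using less.prems by (simp add: num_conn_0 conn_lists_0)
  next
    case (Suc q)
    then have IH: "\<And>k B. k \<le> q \<Longrightarrow> finite B \<Longrightarrow> card (conn_lists B k) = num_conn (card B) k"
      using less.IH by simp
    note rec = card_conn_lists_rec[where r = q, OF _ IH]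
    from rec[OF less.prems] rec[OF finite_lessThan[of "card A"]]
    show ?thesis by (simp add: Suc num_conn_def)
  qed
qed

lemma num_conn_Suc:
  "2 * num_conn d (Suc r) = d * (d - 1) * num_conn d r
      + (\<Sum>i\<le>d. (d choose i) * (i * (d - i) *
        (\<Sum>k\<le>r. (r choose k) * num_conn i k * num_conn (d - i) (r - k))))"
  using card_conn_lists_rec[OF finite_lessThan[of d] card_conn_lists] by (simp add: card_conn_lists)

section \<open>The cut-and-join equation\<close>

text \<open>The value at 0 is set by hand because the empty set counts as connected,
  \<open>num_conn 0 0 = 1\<close>, but is not a component.\<close>

definition conn_ser :: "nat \<Rightarrow> real fps" where
  "conn_ser d = (if d = 0 then 0 else Abs_fps (\<lambda>r. real (num_conn d r) / (fact d * fact r)))"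

text \<open>The vanishing condition says that \<open>d\<close> points need at least
  \<open>d - 1\<close> edges. The parameter \<open>c\<close> is kept free because the equation is
  used with \<open>c = 1\<close> for transpositions and with \<open>c = 0\<close> after the change
  of gauge.\<close>

definition cut_join :: "real \<Rightarrow> (nat \<Rightarrow> real fps) \<Rightarrow> bool" where
  "cut_join c C \<longleftrightarrow> C 0 = 0 \<and> (\<forall>d r. r + 1 < d \<longrightarrow> C d $ r = 0) \<and>
     (\<forall>d. fps_deriv (C d) = fps_const ((real d ^ 2 - c * real d) / 2) * C d
        + fps_const (1/2) * (\<Sum>i\<le>d. fps_const (real i * real (d - i)) * (C i * C (d - i))))"

lemma conn_ser_deriv:
  "fps_deriv (conn_ser d) = fps_const ((real d ^ 2 - 1 * real d) / 2) * conn_ser d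
     + fps_const (1/2) * (\<Sum>i\<le>d. fps_const (real i * real (d - i)) * (conn_ser i * conn_ser (d - i)))"
proof (cases "d = 0")
  case True
  then show ?thesis by (simp add: conn_ser_def)
next
  case False
  show ?thesis
  proof (rule fps_ext)
    fix r
    \<comment> \<open>For \<open>0 < i < d\<close> the two binomials are absorbed by the factorials
      of the exponential generating functions. At the ends \<open>conn_ser\<close> and
      \<open>num_conn\<close> disagree, but there the factor \<open>i * (d - i)\<close> is
      zero.\<close>
    have trm: "real i * real (d - i) * (\<Sum>k=0..r. conn_ser i $ k * conn_ser (d - i) $ (r - k)) =
        real ((d choose i) * (i * (d - i) *
        (\<Sum>k\<le>r. (r choose k) * num_conn i k * num_conn (d - i) (r - k)))) / (fact d * fact r)"
      if "i \<le> d" for i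
    proof (cases "i = 0 \<or> i = d")
      case True
      then show ?thesis by auto
    next
      case False
      have "(\<Sum>k=0..r. conn_ser i $ k * conn_ser (d - i) $ (r - k)) =
        (\<Sum>k\<le>r. real (d choose i) * (real (r choose k) * num_conn i k * num_conn (d - i) (r - k)) / (fact d * fact r))"
        unfolding atMost_atLeast0
      proof (rule sum.cong[OF refl])
        fix k assume "k \<in> {0..r}"
        then have "real (r choose k) = fact r / (fact k * fact (r - k))" by (simp add: binomial_fact)
        moreover have "real (d choose i) = fact d / (fact i * fact (d - i))"
          using that by (simp add: binomial_fact)
        ultimately show "conn_ser i $ k * conn_ser (d - i) $ (r - k) =
           real (d choose i) * (real (r choose k) * num_conn i k * num_conn (d - i) (r - k)) / (fact d * fact r)"
          using False that by (simp only:) (simp add: conn_ser_def)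
      qed
      also have "\<dots> = real (d choose i) * (\<Sum>k\<le>r. real (r choose k) * num_conn i k * num_conn (d - i) (r - k)) / (fact d * fact r)"
        by (simp add: sum_distrib_left sum_divide_distrib)
      finally show ?thesis by simp
    qed
    have "real (r + 1) * conn_ser d $ (r + 1) = real (num_conn d (Suc r)) / (fact d * fact r)"
      using False by (simp add: conn_ser_def field_simps del: of_nat_Suc)
    also have "real (num_conn d (Suc r)) = (real d * (real d - 1) * num_conn d r
      + (\<Sum>i\<le>d. real ((d choose i) * (i * (d - i) *
        (\<Sum>k\<le>r. (r choose k) * num_conn i k * num_conn (d - i) (r - k)))))) / 2"
      using arg_cong[OF num_conn_Suc[of d r], of real] False by (simp add: of_nat_diff)
    also have "\<dots> / (fact d * fact r) = (real d ^ 2 - real d) / 2 * conn_ser d $ r +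
       1 / 2 * (\<Sum>i\<le>d. real i * real (d - i) * (\<Sum>k=0..r. conn_ser i $ k * conn_ser (d - i) $ (r - k)))"
    proof -
      have "(\<Sum>i\<le>d. real i * real (d - i) * (\<Sum>k=0..r. conn_ser i $ k * conn_ser (d - i) $ (r - k))) =
        (\<Sum>i\<le>d. real ((d choose i) * (i * (d - i) *
        (\<Sum>k\<le>r. (r choose k) * num_conn i k * num_conn (d - i) (r - k)))) / (fact d * fact r))"
        by (intro sum.cong refl trm) simp
      also have "\<dots> = (\<Sum>i\<le>d. real ((d choose i) * (i * (d - i) *
        (\<Sum>k\<le>r. (r choose k) * num_conn i k * num_conn (d - i) (r - k))))) / (fact d * fact r)"
        by (simp add: sum_divide_distrib)
      finally have e: "(\<Sum>i\<le>d. real i * real (d - i) * (\<Sum>k=0..r. conn_ser i $ k * conn_ser (d - i) $ (r - k))) =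
        (\<Sum>i\<le>d. real ((d choose i) * (i * (d - i) *
        (\<Sum>k\<le>r. (r choose k) * num_conn i k * num_conn (d - i) (r - k))))) / (fact d * fact r)" .
      have "conn_ser d $ r = real (num_conn d r) / (fact d * fact r)" using False by (simp add: conn_ser_def)
      then have "(real d * (real d - 1) * num_conn d r + s) / 2 / (fact d * fact r) =
          (real d ^ 2 - real d) / 2 * conn_ser d $ r + 1 / 2 * (s / (fact d * fact r))" for s :: real
        by (simp add: field_simps power2_eq_square)
      then show ?thesis unfolding e .
    qed
    finally show "fps_deriv (conn_ser d) $ r = (fps_const ((real d ^ 2 - 1 * real d) / 2) * conn_ser d
     + fps_const (1/2) * (\<Sum>i\<le>d. fps_const (real i * real (d - i)) * (conn_ser i * conn_ser (d - i)))) $ r"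
      by (simp add: fps_sum_nth fps_mult_nth[where f = "conn_ser i" and g = "conn_ser (d - i)" for i])
  qed
qed

text \<open>Obtained from the differential equation by induction on \<open>r\<close>: with too few
  edges in total, one of the two components in each product also has too few.\<close>

lemma conn_ser_eq_0: "r + 1 < d \<Longrightarrow> conn_ser d $ r = 0"
proof (induction r arbitrary: d rule: less_induct)
  case (less r)
  show ?case
  proof (cases r)
    case 0
    then show ?thesis using less.prems by (simp add: conn_ser_def num_conn_0)
  next
    case (Suc q)
    have "conn_ser i $ k * conn_ser (d - i) $ (q - k) = 0" if "k \<le> q" "i \<le> d" for i k
    proof (cases "k + 1 < i")
      case True
      then show ?thesis using less.IH[of k i] that Suc by auto
    next
      case False
      then have "q - k + 1 < d - i" using less.prems Suc that by auto
      then show ?thesis using less.IH[of "q - k" "d - i"] that Suc by auto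
    qed
    then have "(conn_ser i * conn_ser (d - i)) $ q = 0" if "i \<le> d" for i
      using that unfolding fps_mult_nth by (intro sum.neutral) auto
    moreover have "conn_ser d $ q = 0" using less.IH[of q d] less.prems Suc by auto
    ultimately have "fps_deriv (conn_ser d) $ q = 0"
      by (subst conn_ser_deriv) (simp add: fps_sum_nth)
    then show ?thesis using Suc by simp
  qed
qed

lemma cut_join_conn_ser: "cut_join 1 conn_ser"
  using conn_ser_eq_0 conn_ser_deriv by (simp add: cut_join_def conn_ser_def[of 0])

section \<open>Changing the linear coefficient by an exponential factor\<close>

definition gauge :: "real \<Rightarrow> (nat \<Rightarrow> real fps) \<Rightarrow> nat \<Rightarrow> real fps" where
  "gauge c C d = fps_exp (c * real d) * C d"

text \<open>The exponentials for \<open>i\<close> and \<open>d - i\<close> multiply to the one for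
  \<open>d\<close>, so the quadratic term scales like \<open>C d\<close> itself. Differentiating the
  factor adds \<open>b * d\<close> to the coefficient of \<open>C d\<close>.\<close>

lemma cut_join_gauge:
  assumes "cut_join c C"
  shows "cut_join (c - 2 * b) (gauge b C)"
proof -
  have "gauge b C d $ r = 0" if "r + 1 < d" for d r
    using assms that by (simp add: gauge_def cut_join_def fps_mult_nth)
  moreover have "fps_deriv (gauge b C d) = fps_const ((real d ^ 2 - (c - 2 * b) * real d) / 2) * gauge b C d
        + fps_const (1/2) * (\<Sum>i\<le>d. fps_const (real i * real (d - i)) * (gauge b C i * gauge b C (d - i)))" for d
  proof -
    have e: "gauge b C i * gauge b C (d - i) = fps_exp (b * real d) * (C i * C (d - i))" if "i \<le> d" for i
    proof -
      have "fps_exp (b * real d) = fps_exp (b * real i) * fps_exp (b * real (d - i))"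
        using that by (simp add: fps_exp_add_mult[symmetric] of_nat_diff algebra_simps)
      then show ?thesis by (simp add: gauge_def)
    qed
    have s: "(\<Sum>i\<le>d. fps_const (real i * real (d - i)) * (gauge b C i * gauge b C (d - i))) =
       fps_exp (b * real d) * (\<Sum>i\<le>d. fps_const (real i * real (d - i)) * (C i * C (d - i)))"
      by (simp add: sum_distrib_left e ac_simps)
    have C: "fps_deriv (C d) = fps_const ((real d ^ 2 - c * real d) / 2) * C d
        + fps_const (1/2) * (\<Sum>i\<le>d. fps_const (real i * real (d - i)) * (C i * C (d - i)))"
      using assms by (simp add: cut_join_def)
    have k: "fps_const ((real d ^ 2 - (c - 2 * b) * real d) / 2) =
        fps_const ((real d ^ 2 - c * real d) / 2) + fps_const (b * real d)"
      by (simp add: field_simps)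
    show ?thesis unfolding s k by (simp add: gauge_def C algebra_simps del: fps_const_add)
  qed
  ultimately show ?thesis using assms by (simp add: cut_join_def gauge_def[of _ _ 0])
qed

text \<open>For graphs with \<open>d\<close> vertices and \<open>d + m - 1\<close> edges,
  \<open>m\<close> is the first Betti number, so this collects the connected graphs with
  \<open>m\<close> independent cycles. With \<open>d = 0\<close> excluded, the subtraction is never
  truncated.\<close>

definition diag :: "(nat \<Rightarrow> real fps) \<Rightarrow> nat \<Rightarrow> real fps" where
  "diag C m = Abs_fps (\<lambda>d. if d = 0 then 0 else C d $ (d + m - 1))"

definition xD :: "real fps \<Rightarrow> real fps" where
  "xD f = fps_X * fps_deriv f"

lemma xD_nth [simp]: "xD f $ d = real d * f $ d"
  by (cases d) (simp_all add: xD_def)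

text \<open>Deleting a bridge splits the Betti number:
  \<open>(i + a - 1) + (d - i + M - a - 1) = r\<close>. All other terms of the Cauchy product vanish
  because one factor has too few edges.\<close>

lemma cut_join_conv:
  assumes "cut_join c C" "0 < i" "i < d" "r + 2 = d + M"
  shows "(C i * C (d - i)) $ r = (\<Sum>a\<le>M. diag C a $ i * diag C (M - a) $ (d - i))"
proof -
  have van: "C d $ r = 0" if "r + 1 < d" for d r using assms(1) that by (simp add: cut_join_def)
  have "(\<Sum>a\<le>M. diag C a $ i * diag C (M - a) $ (d - i)) =
      (\<Sum>k\<in>{i - 1..i - 1 + M}. C i $ k * C (d - i) $ (r - k))"
  proof (rule sum.reindex_bij_witness[of _ "\<lambda>k. k - (i - 1)" "\<lambda>a. a + (i - 1)"])
    fix a assume a: "a \<in> {..M}"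
    then have "d - i + (M - a) - 1 = r - (a + (i - 1))" "i + a - 1 = a + (i - 1)" using assms by auto
    then show "C i $ (a + (i - 1)) * C (d - i) $ (r - (a + (i - 1))) = diag C a $ i * diag C (M - a) $ (d - i)"
      using assms by (simp add: diag_def)
  qed (use assms in auto)
  also have "\<dots> = (\<Sum>k=0..r. C i $ k * C (d - i) $ (r - k))"
  proof (rule sum.mono_neutral_left)
    show "\<forall>k\<in>{0..r} - {i - 1..i - 1 + M}. C i $ k * C (d - i) $ (r - k) = 0"
    proof
      fix k assume k: "k \<in> {0..r} - {i - 1..i - 1 + M}"
      show "C i $ k * C (d - i) $ (r - k) = 0"
      proof (cases "k + 1 < i")
        case False
        then have "r - k + 1 < d - i" using k assms by auto
        then show ?thesis using van by simp
      qed (use van in simp)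
    qed
  qed (use assms in auto)
  finally show ?thesis by (simp add: fps_mult_nth)
qed

text \<open>The additive form \<open>r + 2 = d + M\<close> covers both \<open>M = m + 1\<close>,
  where \<open>C d $ r\<close> is a coefficient of \<open>diag C m\<close>, and
  \<open>M = 0\<close>, where it is zero.\<close>

lemma cut_join_coeff:
  assumes C: "cut_join c C" and r: "r + 2 = d + M" and d: "0 < d"
  shows "real (r + 1) * diag C M $ d = (real d ^ 2 - c * real d) / 2 * C d $ r
     + 1/2 * (\<Sum>a\<le>M. xD (diag C a) * xD (diag C (M - a))) $ d"
proof -
  have "d + M - 1 = r + 1" using r by simp
  then have "diag C M $ d = C d $ (r + 1)" using d by (simp add: diag_def)
  then have "real (r + 1) * diag C M $ d = fps_deriv (C d) $ r" by simp
  also have "\<dots> = (real d ^ 2 - c * real d) / 2 * C d $ r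
        + 1/2 * (\<Sum>i\<le>d. real i * real (d - i) * (C i * C (d - i)) $ r)"
  proof -
    have "fps_deriv (C d) = fps_const ((real d ^ 2 - c * real d) / 2) * C d
        + fps_const (1/2) * (\<Sum>i\<le>d. fps_const (real i * real (d - i)) * (C i * C (d - i)))"
      using C by (simp add: cut_join_def)
    then show ?thesis by (simp add: fps_sum_nth)
  qed
  also have "(\<Sum>i\<le>d. real i * real (d - i) * (C i * C (d - i)) $ r) =
      (\<Sum>i\<le>d. \<Sum>a\<le>M. xD (diag C a) $ i * xD (diag C (M - a)) $ (d - i))"
  proof (rule sum.cong[OF refl])
    fix i assume "i \<in> {..d}"
    show "real i * real (d - i) * (C i * C (d - i)) $ r = (\<Sum>a\<le>M. xD (diag C a) $ i * xD (diag C (M - a)) $ (d - i))"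
    proof (cases "i = 0 \<or> i = d")
      case False
      then show ?thesis using cut_join_conv[OF C _ _ r, of i] \<open>i \<in> {..d}\<close>
        by (simp add: sum_distrib_left ac_simps)
    qed auto
  qed
  also have "\<dots> = (\<Sum>a\<le>M. \<Sum>i\<le>d. xD (diag C a) $ i * xD (diag C (M - a)) $ (d - i))"
    by (rule sum.swap)
  also have "\<dots> = (\<Sum>a\<le>M. xD (diag C a) * xD (diag C (M - a))) $ d"
    by (simp add: fps_sum_nth fps_mult_nth atMost_atLeast0)
  finally show ?thesis .
qed

lemma diag_rec:
  assumes "cut_join c C"
  shows "of_nat m * diag C (m + 1) + xD (diag C (m + 1)) =
     fps_const (1/2) * (xD (xD (diag C m)) - fps_const c * xD (diag C m)
       + (\<Sum>a\<le>m + 1. xD (diag C a) * xD (diag C (m + 1 - a))))"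
proof (rule fps_ext)
  fix d
  show "(of_nat m * diag C (m + 1) + xD (diag C (m + 1))) $ d =
     (fps_const (1/2) * (xD (xD (diag C m)) - fps_const c * xD (diag C m)
       + (\<Sum>a\<le>m + 1. xD (diag C a) * xD (diag C (m + 1 - a))))) $ d"
  proof (cases "d = 0")
    case True
    have "(xD f * g) $ 0 = 0" for f g by simp
    then show ?thesis using True by (simp add: fps_sum_nth diag_def)
  next
    case False
    define R where "R = (\<Sum>a\<le>m + 1. xD (diag C a) * xD (diag C (m + 1 - a)))"
    have "C d $ (d + m - 1) = diag C m $ d" using False by (simp add: diag_def)
    moreover have "real (d + m - 1 + 1) = real d + real m" using False by simp
    ultimately have "(real d + real m) * diag C (m + 1) $ d =
        (real d ^ 2 - c * real d) / 2 * diag C m $ d + 1/2 * R $ d"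
      using cut_join_coeff[OF assms, of "d + m - 1" d "m + 1"] False unfolding R_def by simp
    then show ?thesis unfolding R_def[symmetric]
      by (simp add: fps_of_nat[symmetric] power2_eq_square field_simps)
  qed
qed

text \<open>The case of trees, formally \<open>m = -1\<close> in \<open>diag_rec\<close>. The linear
  term disappears since \<open>d - 2\<close> edges cannot connect \<open>d\<close> points;
  \<open>d = 1\<close> is separate because there is no matching \<open>r\<close>.\<close>

lemma diag_rec_0:
  assumes "cut_join c C"
  shows "xD (diag C 0) - diag C 0 = fps_const (1/2) * xD (diag C 0) ^ 2"
proof (rule fps_ext)
  fix d :: nat
  consider "d = 0" | "d = 1" | "2 \<le> d" by linarith
  then show "(xD (diag C 0) - diag C 0) $ d = (fps_const (1/2) * xD (diag C 0) ^ 2) $ d"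
  proof cases
    case 3
    have "C d $ (d - 2) = 0" using assms 3 by (simp add: cut_join_def)
    moreover have "real (d - 2 + 1) = real d - 1" "d - 2 + 2 = d + 0" using 3 by auto
    ultimately have "(real d - 1) * diag C 0 $ d = 1/2 * (xD (diag C 0) ^ 2) $ d"
      using cut_join_coeff[OF assms, of "d - 2" d 0] 3 by (simp add: power2_eq_square)
    then show ?thesis unfolding fps_mult_left_const_nth by (simp add: algebra_simps)
  qed (auto simp: diag_def power2_eq_square fps_mult_nth)
qed

section \<open>The Riemann-Hurwitz relation\<close>

text \<open>The equivalence relation on \<open>V\<close> generated by \<open>G\<close>. Cycles of a
  permutation and components of a tuple both become its classes, so one merging lemma serves for
  both.\<close>

definition eqcl :: "'a set \<Rightarrow> ('a \<times> 'a) set \<Rightarrow> ('a \<times> 'a) set" where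
  "eqcl V G = {(i, j). i \<in> V \<and> j \<in> V \<and> (i, j) \<in> (G \<union> G\<inverse>)\<^sup>*}"

lemma sym_rtrancl_Un_converse: "sym ((G \<union> G\<inverse>)\<^sup>*)"
  by (intro sym_rtrancl sym_Un_converse)

lemma equiv_eqcl: "equiv V (eqcl V G)"
proof (rule equivI)
  show "sym (eqcl V G)"
    using sym_rtrancl_Un_converse[of G] by (auto simp: eqcl_def sym_def)
  show "trans (eqcl V G)" by (auto simp: eqcl_def trans_def intro: rtrancl_trans)
qed (auto simp: eqcl_def refl_on_def)

lemma eqcl_subset:
  assumes "G \<subseteq> (H \<union> H\<inverse>)\<^sup>*"
  shows "eqcl V G \<subseteq> eqcl V H"
proof -
  have "G \<union> G\<inverse> \<subseteq> (H \<union> H\<inverse>)\<^sup>*" using assms sym_rtrancl_Un_converse[of H] by (auto dest: symD)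
  then have "(G \<union> G\<inverse>)\<^sup>* \<subseteq> (H \<union> H\<inverse>)\<^sup>*" by (metis rtrancl_idemp rtrancl_mono)
  then show ?thesis by (auto simp: eqcl_def)
qed

text \<open>A new edge merges the classes of its ends and nothing else. The summand
  \<open>Id\<close> admits the loops outside \<open>V\<close> that graphs of permutations of
  \<open>V\<close> contain.\<close>

lemma eqcl_insert:
  assumes G: "G \<subseteq> V \<times> V \<union> Id" and ab: "a \<in> V" "b \<in> V"
  shows "eqcl V (insert (a, b) G) = eqcl V G \<union> eqcl V G `` {a} \<times> eqcl V G `` {b} \<union> eqcl V G `` {b} \<times> eqcl V G `` {a}"
    (is "_ = ?J")
proof
  define R where "R = eqcl V G"
  have R: "equiv V R" by (simp add: R_def equiv_eqcl)
  have symR: "(y, x) \<in> R" if "(x, y) \<in> R" for x y using R that by (meson equivE symD)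
  have transR: "(x, z) \<in> R" if "(x, y) \<in> R" "(y, z) \<in> R" for x y z using R that by (meson equivE transD)
  have reflR: "(x, x) \<in> R" if "x \<in> V" for x using R that by (meson equivE refl_onD)
  have "(i, j) \<in> ?J \<and> j \<in> V" if "i \<in> V" "(i, j) \<in> (insert (a, b) G \<union> (insert (a, b) G)\<inverse>)\<^sup>*" for i j
    using that(2)
  proof induction
    case base
    then show ?case using reflR \<open>i \<in> V\<close> by (auto simp: R_def)
  next
    case (step y z)
    then have y: "y \<in> V" "(i, y) \<in> ?J" by auto
    have "(y, z) \<in> R \<or> (y, z) = (a, b) \<or> (y, z) = (b, a)" "z \<in> V"
      using step(2) y G ab by (auto simp: R_def eqcl_def)
    then show ?case using y ab unfolding R_def[symmetric] using symR transR reflR by blast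
  qed
  then show "eqcl V (insert (a, b) G) \<subseteq> ?J" by (auto simp: eqcl_def)
  have sub: "eqcl V G \<subseteq> eqcl V (insert (a, b) G)" by (rule eqcl_subset) auto
  have e: "equiv V (eqcl V (insert (a, b) G))" by (rule equiv_eqcl)
  have "(a, b) \<in> eqcl V (insert (a, b) G)" using ab by (auto simp: eqcl_def)
  then show "?J \<subseteq> eqcl V (insert (a, b) G)"
    using sub e by (auto simp: equiv_def) (meson subsetD symD transD)+
qed

lemma card_quotient_eqcl_insert:
  assumes fin: "finite V" and G: "G \<subseteq> V \<times> V \<union> Id" and ab: "a \<in> V" "b \<in> V"
  shows "card (V // eqcl V G) = card (V // eqcl V (insert (a, b) G)) + (if (a, b) \<in> eqcl V G then 0 else 1)"
proof -
  define R where "R = eqcl V G"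
  define J where "J = eqcl V (insert (a, b) G)"
  define A where "A = R `` {a}"
  define B where "B = R `` {b}"
  have R: "equiv V R" by (simp add: R_def equiv_eqcl)
  have symR: "(y, x) \<in> R" if "(x, y) \<in> R" for x y using R that by (meson equivE symD)
  have transR: "(x, z) \<in> R" if "(x, y) \<in> R" "(y, z) \<in> R" for x y z using R that by (meson equivE transD)
  have reflR: "(x, x) \<in> R" if "x \<in> V" for x using R that by (meson equivE refl_onD)
  have J: "J = R \<union> A \<times> B \<union> B \<times> A"
    unfolding J_def A_def B_def R_def by (rule eqcl_insert[OF G ab])
  show ?thesis
  proof (cases "(a, b) \<in> R")
    case True
    then have "A = B" using R by (simp add: A_def B_def equiv_class_eq)
    then have "A \<times> B \<union> B \<times> A \<subseteq> R" using transR symR unfolding A_def by blast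
    then have "J = R" unfolding J by blast
    then show ?thesis using True by (simp add: R_def J_def)
  next
    case False
    have aA: "a \<in> A" "b \<in> B" using reflR ab by (auto simp: A_def B_def)
    have AB: "A \<inter> B = {}" using False symR transR unfolding A_def B_def by blast
    have cls: "J `` {x} = (if x \<in> A \<union> B then A \<union> B else R `` {x})" if "x \<in> V" for x
    proof (cases "x \<in> A \<union> B")
      case True
      then consider "x \<in> A" "R `` {x} = A" "x \<notin> B" | "x \<in> B" "R `` {x} = B" "x \<notin> A"
        using AB R by (auto simp: A_def B_def dest: equiv_class_eq)
      then show ?thesis by cases (auto simp: J)
    next
      case False
      then show ?thesis by (auto simp: J)
    qed
    have mem: "R `` {x} \<noteq> A" "R `` {x} \<noteq> B" if "x \<in> V" "x \<notin> A \<union> B" for x using reflR that by auto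
    have mem2: "R `` {x} = A \<or> R `` {x} = B" if "x \<in> A \<union> B" for x
      using that R by (auto simp: A_def B_def dest: equiv_class_eq)
    have Q: "V // J = insert (A \<union> B) (V // R - {A, B})"
    proof (intro set_eqI iffI)
      fix S assume "S \<in> V // J"
      then obtain x where "x \<in> V" "S = J `` {x}" by (auto elim: quotientE)
      then show "S \<in> insert (A \<union> B) (V // R - {A, B})"
        using cls[of x] mem[of x] by (auto intro: quotientI)
    next
      fix S assume "S \<in> insert (A \<union> B) (V // R - {A, B})"
      then consider "S = A \<union> B" | x where "x \<in> V" "S = R `` {x}" "S \<noteq> A" "S \<noteq> B"
        by (auto elim: quotientE)
      then show "S \<in> V // J"
      proof cases
        case 1
        then have "S = J `` {a}" using cls[OF ab(1)] aA by simp
        then show ?thesis using ab(1) by (auto intro: quotientI)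
      next
        case 2
        then have "x \<notin> A \<union> B" using mem2[of x] by auto
        then have "S = J `` {x}" using cls[OF 2(1)] 2 by simp
        then show ?thesis using 2(1) by (auto intro: quotientI)
      qed
    qed
    have "A \<union> B \<notin> V // R"
    proof
      assume "A \<union> B \<in> V // R"
      then have "(a, b) \<in> R" using aA R by (metis UnI1 UnI2 quotient_eq_iff)
      with False show False by simp
    qed
    moreover have "finite (V // R)" using fin R by (meson equiv_type finite_quotient)
    moreover have "A \<in> V // R" "B \<in> V // R" "A \<noteq> B"
      using ab aA AB by (auto simp: A_def B_def intro: quotientI)
    ultimately have "card (V // J) = card (V // R) - 2 + 1" "card (V // R) \<ge> 2"
      using card_mono[of "V // R" "{A, B}"]
      by (auto simp: Q card_insert_if card_Diff_subset)
    then show ?thesis using False by (simp add: R_def J_def)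
  qed
qed

section \<open>Cycles of a permutation multiplied by a transposition\<close>

definition gr :: "('a \<Rightarrow> 'a) \<Rightarrow> ('a \<times> 'a) set" where
  "gr p = {(i, p i) | i. True}"

definition ncyc :: "'a set \<Rightarrow> ('a \<Rightarrow> 'a) \<Rightarrow> nat" where
  "ncyc V p = card (V // eqcl V (gr p))"

lemma gr_permutes: "p permutes V \<Longrightarrow> gr p \<subseteq> V \<times> V \<union> Id"
  by (auto simp: gr_def permutes_in_image) (metis permutes_def)+

lemma permutes_orbit:
  assumes "finite V" "p permutes V" "i \<in> V"
  shows "eqcl V (gr p) `` {i} = range (\<lambda>k. (p ^^ k) i)"
proof
  have "permutation p" using assms permutes_imp_permutation by blast
  then obtain n where n: "p ^^ n = id" "n > 0" using permutation_is_nilpotent by blast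
  have "y \<in> range (\<lambda>k. (p ^^ k) i)" if "(i, y) \<in> (gr p \<union> (gr p)\<inverse>)\<^sup>*" for y
    using that
  proof induction
    case base
    show ?case by (rule range_eqI[of _ _ 0]) simp
  next
    case (step y z)
    then obtain k where k: "y = (p ^^ k) i" by auto
    from step(2) consider "z = p y" | "y = p z" by (auto simp: gr_def)
    then show ?case
    proof cases
      case 1
      then show ?thesis using k by (intro range_eqI[of _ _ "Suc k"]) simp
    next
      case 2
      \<comment> \<open>A backward step is a forward power, since \<open>p\<close> has finite order
        \<open>n\<close>.\<close>
      have "z = (p ^^ n) z" using n by simp
      also have "\<dots> = (p ^^ (n - 1)) (p z)" using n(2) by (cases n) (simp_all add: funpow_swap1)
      also have "\<dots> = (p ^^ (n - 1 + k)) i" using 2 k by (simp add: funpow_add)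
      finally show ?thesis by (rule range_eqI)
    qed
  qed
  then show "eqcl V (gr p) `` {i} \<subseteq> range (\<lambda>k. (p ^^ k) i)" by (auto simp: eqcl_def)
  have "(p ^^ k) i \<in> V \<and> (i, (p ^^ k) i) \<in> (gr p \<union> (gr p)\<inverse>)\<^sup>*" for k
  proof (induction k)
    case (Suc k)
    have "((p ^^ k) i, p ((p ^^ k) i)) \<in> gr p \<union> (gr p)\<inverse>" by (auto simp: gr_def)
    with Suc show ?case using assms by (auto simp: permutes_in_image intro: rtrancl_into_rtrancl)
  qed (use assms in auto)
  then show "range (\<lambda>k. (p ^^ k) i) \<subseteq> eqcl V (gr p) `` {i}" using assms by (auto simp: eqcl_def)
qed

lemma funpow_range_period:
  assumes "(f ^^ k) a = a" "0 < k"
  shows "range (\<lambda>n. (f ^^ n) a) = (\<lambda>n. (f ^^ n) a) ` {..<k}"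
proof -
  have "(f ^^ n) a = (f ^^ (n mod k)) a" for n using funpow_mod_eq[OF assms(1), of n] by simp
  moreover have "n mod k < k" for n using assms(2) by simp
  ultimately have "(f ^^ n) a \<in> (\<lambda>n. (f ^^ n) a) ` {..<k}" for n by (metis imageI lessThan_iff)
  then show ?thesis by auto
qed

text \<open>Follow the orbit of \<open>a\<close> until it first returns to \<open>{a, b}\<close>: up to that point \<open>p\<close> and
  \<open>transpose a b \<circ> p\<close> agree, and there they disagree about which of \<open>a\<close>, \<open>b\<close> is hit.\<close>

lemma transpose_toggles_cycle:
  assumes fin: "finite V" and p: "p permutes V" and ab: "a \<in> V" "b \<in> V" "a \<noteq> b"
  shows "(a, b) \<in> eqcl V (gr (transpose a b \<circ> p)) \<longleftrightarrow> (a, b) \<notin> eqcl V (gr p)"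
proof -
  define q where "q = transpose a b \<circ> p"
  have q: "q permutes V" unfolding q_def using p ab by (intro permutes_compose permutes_swap_id)
  have orb: "(a, b) \<in> eqcl V (gr f) \<longleftrightarrow> b \<in> range (\<lambda>k. (f ^^ k) a)" if "f permutes V" for f
    using permutes_orbit[OF fin that ab(1)] by auto
  obtain n where n: "p ^^ n = id" "n > 0"
    using permutes_imp_permutation[OF fin p] permutation_is_nilpotent by blast
  define k where "k = (LEAST k. 0 < k \<and> (p ^^ k) a \<in> {a, b})"
  have k: "0 < k" "(p ^^ k) a \<in> {a, b}"
    using LeastI[of "\<lambda>k. 0 < k \<and> (p ^^ k) a \<in> {a, b}" n] n by (auto simp: k_def)
  have less: "(p ^^ i) a \<notin> {a, b}" if "0 < i" "i < k" for i
    using not_less_Least[of i "\<lambda>k. 0 < k \<and> (p ^^ k) a \<in> {a, b}"] that by (auto simp: k_def)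
  have qi: "(q ^^ i) a = (p ^^ i) a" if "i < k" for i
    using that
  proof (induction i)
    case (Suc i)
    then show ?case using less[of "Suc i"] by (simp add: q_def transpose_def)
  qed simp
  have qk: "(q ^^ k) a = transpose a b ((p ^^ k) a)"
    using k(1) qi[of "k - 1"] by (cases k) (simp_all add: q_def)
  have nb: "b \<notin> (\<lambda>i. (p ^^ i) a) ` {..<k}"
    using less ab(3) by (auto simp: image_iff) (metis funpow_0 gr0I)
  have nbq: "b \<notin> (\<lambda>i. (q ^^ i) a) ` {..<k}" using nb qi by auto
  show ?thesis
  proof (cases "(p ^^ k) a = a")
    case True
    then have "b \<notin> range (\<lambda>i. (p ^^ i) a)" using funpow_range_period[OF True k(1)] nb by simp
    moreover have "(q ^^ k) a = b" using True qk by simp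
    ultimately show ?thesis unfolding q_def[symmetric] orb[OF q] orb[OF p] by auto
  next
    case False
    then have b: "(p ^^ k) a = b" using k by simp
    then have "(q ^^ k) a = a" using qk by simp
    then have "b \<notin> range (\<lambda>i. (q ^^ i) a)" using funpow_range_period[OF _ k(1)] nbq by metis
    with b show ?thesis unfolding q_def[symmetric] orb[OF q] orb[OF p] by auto
  qed
qed

text \<open>Once \<open>a\<close> and \<open>b\<close> are joined, following \<open>p\<close> or
  following \<open>transpose a b \<circ> p\<close> leads to the same classes. Composing twice gives
  \<open>p\<close> back, so this inclusion yields equality.\<close>

lemma eqcl_transpose_subset:
  "eqcl V (insert (a, b) (gr p)) \<subseteq> eqcl V (insert (a, b) (gr (transpose a b \<circ> p)))"
proof (rule eqcl_subset)
  let ?H = "insert (a, b) (gr (transpose a b \<circ> p))"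
  have "(i, p i) \<in> (?H \<union> ?H\<inverse>)\<^sup>*" for i
  proof -
    have "(i, transpose a b (p i)) \<in> ?H \<union> ?H\<inverse>" by (auto simp: gr_def)
    moreover have "(transpose a b (p i), p i) \<in> (?H \<union> ?H\<inverse>)\<^sup>*" by (auto simp: transpose_def)
    ultimately show ?thesis by (rule converse_rtrancl_into_rtrancl)
  qed
  then show "insert (a, b) (gr p) \<subseteq> (?H \<union> ?H\<inverse>)\<^sup>*" by (auto simp: gr_def)
qed

lemma eqcl_transpose: "eqcl V (insert (a, b) (gr (transpose a b \<circ> p))) = eqcl V (insert (a, b) (gr p))"
  using eqcl_transpose_subset[of V a b p] eqcl_transpose_subset[of V a b "transpose a b \<circ> p"]
  by (simp add: comp_assoc[symmetric])

text \<open>Both cycle counts are compared with the number of classes after joining \<open>a\<close>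
  and \<open>b\<close>, which is the same for the two permutations; exactly one of them drops by one
  under the joining.\<close>

lemma ncyc_transpose:
  assumes "finite V" "p permutes V" "a \<in> V" "b \<in> V" "a \<noteq> b"
  shows "if (a, b) \<in> eqcl V (gr p) then ncyc V (transpose a b \<circ> p) = ncyc V p + 1
         else ncyc V (transpose a b \<circ> p) + 1 = ncyc V p"
proof -
  have "transpose a b \<circ> p permutes V" using assms by (intro permutes_compose permutes_swap_id)
  then show ?thesis
    using card_quotient_eqcl_insert[OF assms(1) gr_permutes[OF assms(2)] assms(3,4)]
      card_quotient_eqcl_insert[OF assms(1) gr_permutes assms(3,4), of "transpose a b \<circ> p"]
      transpose_toggles_cycle[OF assms]
    by (simp add: eqcl_transpose ncyc_def)
qed

section \<open>Components and the genus bound\<close>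

definition ncomp :: "nat set \<Rightarrow> (nat \<Rightarrow> nat) set \<Rightarrow> nat" where
  "ncomp V X = card (V // eqcl V (edge X))"

lemma eqcl_edge_insert:
  "eqcl V (edge (insert (transpose a b) X)) = eqcl V (insert (a, b) (edge X))"
proof
  show "eqcl V (edge (insert (transpose a b) X)) \<subseteq> eqcl V (insert (a, b) (edge X))"
    by (rule eqcl_subset) (auto simp: edge_def transpose_def)
  have "(a, b) \<in> edge (insert (transpose a b) X)"
    using edgeI[of "transpose a b" "insert (transpose a b) X" a] by simp
  then have "insert (a, b) (edge X) \<subseteq> edge (insert (transpose a b) X)"
    using edge_mono[of X "insert (transpose a b) X"] by auto
  then show "eqcl V (insert (a, b) (edge X)) \<subseteq> eqcl V (edge (insert (transpose a b) X))"
    by (intro eqcl_subset) auto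
qed

lemma edge_transps_subset: "X \<subseteq> transps V \<Longrightarrow> edge X \<subseteq> V \<times> V \<union> Id"
  by (auto simp: edge_def) (metis subsetD transps_inside transps_outside)+

lemma ncomp_conn:
  assumes "conn V X" "V \<noteq> {}"
  shows "ncomp V X = 1"
proof -
  have "eqcl V (edge X) = V \<times> V"
    using assms(1) rtrancl_mono[of "edge X" "edge X \<union> (edge X)\<inverse>"] by (auto simp: eqcl_def conn_def)
  then have "V // eqcl V (edge X) = {V}" using assms(2) by (auto simp: quotient_def)
  then show ?thesis by (simp add: ncomp_def)
qed

lemma card_quotient_Id_on: "card (V // Id_on V) = card V"
proof -
  have "V // Id_on V = (\<lambda>x. {x}) ` V" by (auto simp: quotient_def Id_on_def)
  then show ?thesis by (simp add: card_image)
qed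

text \<open>The inequality says that the genus is nonnegative, summed over components. Each new
  transposition changes the number of cycles by one, which gives the parity. If it joins two
  components it also joins two cycles, and both sides drop by one; otherwise the left side grows by
  at most one and the right side by exactly one.\<close>

lemma riemann_hurwitz:
  assumes fin: "finite V" and "set ts \<subseteq> transps V"
  shows "perm_prod ts permutes V \<and>
    ncyc V (perm_prod ts) + card V \<le> length ts + 2 * ncomp V (set ts) \<and>
    even (ncyc V (perm_prod ts) + card V + length ts)"
  using assms(2)
proof (induction ts)
  case Nil
  have "eqcl V (gr id) = Id_on V" "eqcl V (edge {}) = Id_on V"
  proof -
    have "gr id \<union> (gr id)\<inverse> = (Id :: (nat \<times> nat) set)" by (auto simp: gr_def)
    then show "eqcl V (gr id) = Id_on V" by (auto simp: eqcl_def)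
    show "eqcl V (edge {}) = Id_on V" by (auto simp: eqcl_def edge_def)
  qed
  moreover have "perm_prod [] = id" by simp
  ultimately show ?case
    using permutes_id[of V] by (simp only: ncyc_def ncomp_def list.set card_quotient_Id_on) auto
next
  case (Cons s ts)
  let ?p = "perm_prod ts" and ?X = "set ts"
  obtain a b where ab: "s = transpose a b" "a \<in> V" "b \<in> V" "a \<noteq> b"
    using Cons.prems by (auto simp: transps_def)
  have X: "?X \<subseteq> transps V" using Cons.prems by simp
  have p: "?p permutes V" using Cons by auto
  \<comment> \<open>Cycles of the product lie inside components of the tuple, so points in different
    components lie in different cycles.\<close>
  have "gr ?p \<subseteq> (edge ?X)\<^sup>*"
    using perm_prod_reach[of ?X] by (auto simp: gr_def)
  then have "gr ?p \<subseteq> (edge ?X \<union> (edge ?X)\<inverse>)\<^sup>*"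
    using rtrancl_mono[of "edge ?X" "edge ?X \<union> (edge ?X)\<inverse>"] by auto
  then have sub: "eqcl V (gr ?p) \<subseteq> eqcl V (edge ?X)" by (rule eqcl_subset)
  have c: "ncomp V ?X = ncomp V (insert s ?X) + (if (a, b) \<in> eqcl V (edge ?X) then 0 else 1)"
    unfolding ncomp_def ab(1) eqcl_edge_insert
    by (rule card_quotient_eqcl_insert[OF fin edge_transps_subset[OF X] ab(2,3)])
  have n: "if (a, b) \<in> eqcl V (gr ?p) then ncyc V (s \<circ> ?p) = ncyc V ?p + 1
         else ncyc V (s \<circ> ?p) + 1 = ncyc V ?p"
    unfolding ab(1) by (rule ncyc_transpose[OF fin p ab(2-)])
  have "s \<circ> ?p permutes V" unfolding ab(1) using p ab by (intro permutes_compose permutes_swap_id)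
  moreover have "ncyc V (s \<circ> ?p) + card V \<le> Suc (length ts) + 2 * ncomp V (insert s ?X)"
    using Cons.IH[OF X] c n sub by (auto split: if_splits)
  moreover have "even (ncyc V (s \<circ> ?p) + card V + Suc (length ts))"
    using Cons.IH[OF X] n by (auto split: if_splits) (metis even_Suc add_Suc)+
  ultimately show ?case by (simp only: perm_prod_simps list.set list.size add_Suc_right add_0_right)
qed

section \<open>Cycle types and automorphisms of profiles\<close>

lemma cycle_type_props:
  assumes p: "p permutes {..<d}"
  shows "size (cycle_type d p) = ncyc {..<d} p" "0 \<notin># cycle_type d p" "sum_mset (cycle_type d p) = d"
proof -
  let ?V = "{..<d}" and ?R = "eqcl {..<d} (gr p)"
  have R: "equiv ?V ?R" by (rule equiv_eqcl)
  have Q: "(\<lambda>i. range (\<lambda>k. (p ^^ k) i)) ` ?V = ?V // ?R"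
    using permutes_orbit[OF _ p] by (auto simp: quotient_def)
  have fin: "finite (?V // ?R)" using R by (meson equiv_type finite_quotient finite_lessThan)
  have finS: "finite S" "S \<noteq> {}" if "S \<in> ?V // ?R" for S
    using that R by (auto simp: in_quotient_imp_non_empty)
       (meson equiv_type finite_equiv_class finite_lessThan)
  show "size (cycle_type d p) = ncyc ?V p" by (simp add: cycle_type_def Q ncyc_def)
  show "0 \<notin># cycle_type d p" using finS fin by (auto simp: cycle_type_def Q)
  have "sum_mset (cycle_type d p) = (\<Sum>S\<in>?V // ?R. card S)"
    by (simp add: cycle_type_def Q sum_unfold_sum_mset)
  also have "\<dots> = card (\<Union> (?V // ?R))"
    using finS quotient_disj[OF R]
    by (intro card_Union_disjoint[symmetric]) (simp_all add: pairwise_def disjnt_def, blast)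
  finally show "sum_mset (cycle_type d p) = d" using Union_quotient[OF R] by simp
qed

text \<open>Orbit-stabiliser for the action on a fixed ordering \<open>\<mu>0\<close>: the
  permutations taking \<open>\<mu>0\<close> to \<open>\<mu>\<close> form a coset of the stabiliser
  of \<open>\<mu>\<close>, and over all orderings these cosets partition the symmetric
  group.\<close>

lemma sum_aut_card: "(\<Sum>\<mu>\<in>{\<mu>. mset \<mu> = M}. aut_card \<mu>) = fact (size M)"
proof -
  obtain \<mu>0 where M: "M = mset \<mu>0" by (metis ex_mset)
  let ?n = "length \<mu>0"
  define P where "P = {\<rho>. \<rho> permutes {..<?n}}"
  have finP: "finite P" by (simp add: P_def finite_permutations)
  have "aut_card \<mu> = card {\<rho> \<in> P. permute_list \<rho> \<mu>0 = \<mu>}" if "\<mu> \<in> {\<mu>. mset \<mu> = M}" for \<mu>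
  proof -
    obtain \<pi> where \<pi>: "\<pi> permutes {..<?n}" "permute_list \<pi> \<mu>0 = \<mu>"
      using mset_eq_permutation[of \<mu> \<mu>0] \<open>\<mu> \<in> _\<close> M by auto
    have len: "length \<mu> = ?n" using \<pi> by auto
    have comp: "permute_list (\<pi> \<circ> \<sigma>) \<mu>0 = permute_list \<sigma> \<mu>" if "\<sigma> permutes {..<?n}" for \<sigma>
      using permute_list_compose[OF that] \<pi> by simp
    have "aut_card \<mu> = card {\<sigma> \<in> P. permute_list \<sigma> \<mu> = \<mu>}"
      unfolding aut_card_def
      by (rule arg_cong[of _ _ card]) (auto simp: len P_def permute_list_nth list_eq_iff_nth_eq)
    also have "\<dots> = card {\<rho> \<in> P. permute_list \<rho> \<mu>0 = \<mu>}"
    proof (rule bij_betw_same_card[of "\<lambda>\<sigma>. \<pi> \<circ> \<sigma>"], rule bij_betw_byWitness[of _ "\<lambda>\<rho>. inv \<pi> \<circ> \<rho>"])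
      show "\<forall>\<sigma>\<in>{\<sigma> \<in> P. permute_list \<sigma> \<mu> = \<mu>}. inv \<pi> \<circ> (\<pi> \<circ> \<sigma>) = \<sigma>"
        using permutes_inv_o[OF \<pi>(1)] by (simp add: comp_assoc[symmetric])
      show "\<forall>\<rho>\<in>{\<rho> \<in> P. permute_list \<rho> \<mu>0 = \<mu>}. \<pi> \<circ> (inv \<pi> \<circ> \<rho>) = \<rho>"
        using permutes_inv_o[OF \<pi>(1)] by (simp add: comp_assoc[symmetric])
      show "(\<lambda>\<sigma>. \<pi> \<circ> \<sigma>) ` {\<sigma> \<in> P. permute_list \<sigma> \<mu> = \<mu>} \<subseteq> {\<rho> \<in> P. permute_list \<rho> \<mu>0 = \<mu>}"
        using comp \<pi> by (auto simp: P_def permutes_compose)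
      show "(\<lambda>\<rho>. inv \<pi> \<circ> \<rho>) ` {\<rho> \<in> P. permute_list \<rho> \<mu>0 = \<mu>} \<subseteq> {\<sigma> \<in> P. permute_list \<sigma> \<mu> = \<mu>}"
      proof clarsimp
        fix \<rho> assume \<rho>: "\<rho> \<in> P" "\<mu> = permute_list \<rho> \<mu>0"
        have i: "inv \<pi> \<circ> \<rho> permutes {..<?n}"
          using \<rho> \<pi> by (auto simp: P_def intro: permutes_compose permutes_inv)
        have "permute_list (inv \<pi> \<circ> \<rho>) \<mu> = permute_list (\<pi> \<circ> (inv \<pi> \<circ> \<rho>)) \<mu>0" using comp[OF i] by simp
        also have "\<pi> \<circ> (inv \<pi> \<circ> \<rho>) = \<rho>" using permutes_inv_o[OF \<pi>(1)] by (simp add: comp_assoc[symmetric])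
        finally show "inv \<pi> \<circ> \<rho> \<in> P \<and> permute_list (inv \<pi> \<circ> \<rho>) (permute_list \<rho> \<mu>0) = permute_list \<rho> \<mu>0"
          using i \<rho> unfolding P_def by (metis mem_Collect_eq)
      qed
    qed
    finally show ?thesis .
  qed
  then have "(\<Sum>\<mu>\<in>{\<mu>. mset \<mu> = M}. aut_card \<mu>) = (\<Sum>\<mu>\<in>{\<mu>. mset \<mu> = M}. card {\<rho> \<in> P. permute_list \<rho> \<mu>0 = \<mu>})"
    by (rule sum.cong[OF refl])
  also have "\<dots> = (\<Sum>\<mu>\<in>{\<mu>. mset \<mu> = M}. \<Sum>\<rho>\<in>{\<rho> \<in> P. permute_list \<rho> \<mu>0 = \<mu>}. 1)" by simp
  also have "\<dots> = (\<Sum>\<rho>\<in>P. 1)"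
    using finP by (intro sum.group) (auto simp: M P_def mset_eq_finite)
  also have "\<dots> = fact (size M)" by (simp add: P_def card_permutations[of _ ?n] M)
  finally show ?thesis .
qed

section \<open>From Hurwitz numbers to connected tuples\<close>

lemma finite_compositions:
  "finite {\<mu> :: nat list. length \<mu> = n \<and> (\<forall>k\<in>set \<mu>. 0 < k) \<and> sum_list \<mu> = d}"
proof (rule finite_subset[OF _ finite_lists_length_eq[of "{..d}" n]])
  show "{\<mu> :: nat list. length \<mu> = n \<and> (\<forall>k\<in>set \<mu>. 0 < k) \<and> sum_list \<mu> = d} \<subseteq>
      {xs. set xs \<subseteq> {..d} \<and> length xs = n}"
    using member_le_sum_list by auto
qed simp

text \<open>The Riemann-Hurwitz relation for one component: \<open>size M\<close> is the number
  \<open>n\<close> of poles, and the parity makes \<open>(m + 1 - n) / 2\<close> a genus.\<close>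

lemma cycle_type_conn_lists:
  assumes "ts \<in> conn_lists {..<d} (d + m - 1)" "0 < d"
  defines "M \<equiv> cycle_type d (perm_prod ts)"
  shows "0 < size M" "size M \<le> m + 1" "even (m + 1 - size M)" "0 \<notin># M" "sum_mset M = d"
proof -
  let ?V = "{..<d}"
  have ts: "length ts = d + m - 1" "set ts \<subseteq> transps ?V" "conn ?V (set ts)"
    using assms(1) by (auto simp: conn_lists_def)
  note RH = riemann_hurwitz[OF finite_lessThan ts(2)]
  note M = cycle_type_props[OF conjunct1[OF RH], folded M_def]
  have "?V \<noteq> {}" using \<open>0 < d\<close> by auto
  then have c: "ncomp ?V (set ts) = 1" using ncomp_conn[OF ts(3)] by simp
  show "0 \<notin># M" "sum_mset M = d" using M by auto
  show "0 < size M" using M \<open>0 < d\<close> by (cases "M = {#}") (auto simp: nonempty_has_size)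
  show le: "size M \<le> m + 1" using RH M(1) c ts(1) \<open>0 < d\<close> by simp
  have "even (size M + d + (d + m - 1))" using RH M(1) ts(1) by simp
  then have "even (m + 1) = even (size M)" using \<open>0 < d\<close> by auto
  then show "even (m + 1 - size M)" using le by (auto simp: even_diff_nat)
qed

text \<open>Double counting of pairs of a profile and a tuple. For a tuple with \<open>n\<close>
  cycles, the orderings of its cycle type carry total weight \<open>n!\<close>.\<close>

lemma sum_aut_card_cycle_type:
  fixes d m n :: nat
  assumes "0 < d"
  defines "L \<equiv> conn_lists {..<d} (d + m - 1)"
  shows "(\<Sum>\<mu>\<in>{\<mu>. length \<mu> = n \<and> (\<forall>k\<in>set \<mu>. 0 < k) \<and> sum_list \<mu> = d}.
      aut_card \<mu> * card {ts \<in> L. cycle_type d (perm_prod ts) = mset \<mu>})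
    = fact n * card {ts \<in> L. size (cycle_type d (perm_prod ts)) = n}"
proof -
  define K where "K = {\<mu> :: nat list. length \<mu> = n \<and> (\<forall>k\<in>set \<mu>. 0 < k) \<and> sum_list \<mu> = d}"
  define ct where "ct ts = cycle_type d (perm_prod ts)" for ts
  have finK: "finite K" unfolding K_def by (rule finite_compositions)
  have finL: "finite L" by (simp add: L_def)
  have "(\<Sum>\<mu>\<in>K. aut_card \<mu> * card {ts \<in> L. ct ts = mset \<mu>}) = (\<Sum>\<mu>\<in>K. \<Sum>ts\<in>{ts \<in> L. ct ts = mset \<mu>}. aut_card \<mu>)"
    by (simp add: mult.commute)
  also have "\<dots> = (\<Sum>ts\<in>L. \<Sum>\<mu>\<in>{\<mu> \<in> K. ct ts = mset \<mu>}. aut_card \<mu>)"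
    by (rule sum.swap_restrict[OF finK finL])
  also have "\<dots> = (\<Sum>ts\<in>L. if size (ct ts) = n then fact n else 0)"
  proof (rule sum.cong[OF refl])
    fix ts assume "ts \<in> L"
    then have ct: "0 \<notin># ct ts" "sum_mset (ct ts) = d"
      using cycle_type_conn_lists[of ts d m] assms by (auto simp: ct_def)
    show "(\<Sum>\<mu>\<in>{\<mu> \<in> K. ct ts = mset \<mu>}. aut_card \<mu>) = (if size (ct ts) = n then fact n else 0)"
    proof (cases "size (ct ts) = n")
      case True
      have "{\<mu> \<in> K. ct ts = mset \<mu>} = {\<mu>. mset \<mu> = ct ts}"
      proof (intro set_eqI iffI)
        fix \<mu> assume "\<mu> \<in> {\<mu>. mset \<mu> = ct ts}"
        then have e: "mset \<mu> = ct ts" by simp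
        have "length \<mu> = n" using True e by (metis size_mset)
        moreover have "sum_list \<mu> = d" using ct(2) e by (metis sum_mset_sum_list)
        moreover have "0 \<notin> set \<mu>" using ct(1) e by (metis set_mset_mset)
        ultimately show "\<mu> \<in> {\<mu> \<in> K. ct ts = mset \<mu>}" using e by (auto simp: K_def intro: gr0I)
      qed auto
      then show ?thesis using True sum_aut_card[of "ct ts"] by simp
    next
      case False
      then have "{\<mu> \<in> K. ct ts = mset \<mu>} = {}" by (auto simp: K_def)
      then show ?thesis using False by (simp only: sum.empty if_False)
    qed
  qed
  also have "\<dots> = fact n * card {ts \<in> L. size (ct ts) = n}"
    using finL by (simp add: sum.If_cases Int_def)
  finally show ?thesis by (simp add: K_def ct_def)
qed

text \<open>All pairs \<open>(g, n)\<close> contributing to \<open>S_H m\<close> share the same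
  number of transpositions, so the inner counts sort one set of connected tuples by the number of
  cycles of the product.\<close>

lemma S_H_eq_diag: "S_H m = diag conn_ser m"
proof (rule fps_ext)
  fix d
  define I where "I = {(g, n). 1 \<le> n \<and> 2 * g + n = m + 1}"
  have finI: "finite I" by (rule finite_subset[of _ "{..m + 1} \<times> {..m + 1}"]) (auto simp: I_def)
  have S: "S_H m $ d = (\<Sum>(g, n)\<in>I. 1 / fact n * F_diag g n $ d)"
    by (simp add: S_H_def I_def fps_sum_nth split_def)
  show "S_H m $ d = diag conn_ser m $ d"
  proof (cases "d = 0")
    case True
    have "F_diag g n $ 0 = 0" if "1 \<le> n" for g n
    proof -
      have "{\<mu> :: nat list. length \<mu> = n \<and> (\<forall>k\<in>set \<mu>. 0 < k) \<and> sum_list \<mu> = 0} = {}"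
      proof -
        have False if "length \<mu> = n" "\<forall>k\<in>set \<mu>. 0 < k" "sum_list \<mu> = 0" for \<mu> :: "nat list"
          using that \<open>1 \<le> n\<close> by (cases \<mu>) auto
        then show ?thesis by blast
      qed
      then show ?thesis unfolding F_diag_def fps_nth_Abs_fps by (simp only: sum.empty)
    qed
    then have "S_H m $ d = 0" unfolding S by (intro sum.neutral) (auto simp: I_def True)
    then show ?thesis using True by (simp add: diag_def)
  next
    case False
    define r where "r = d + m - 1"
    define L where "L = conn_lists {..<d} r"
    define sz where "sz ts = size (cycle_type d (perm_prod ts))" for ts
    have finL: "finite L" by (simp add: L_def)
    have "1 / fact n * F_diag g n $ d = real (card {ts \<in> L. sz ts = n}) / (fact d * fact r)"
      if gn: "(g, n) \<in> I" for g n
    proof -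
      have r: "2 * g + n + d - 2 = r" using gn by (auto simp: I_def r_def)
      have H: "hurwitz_H g \<mu> = real (aut_card \<mu> * card {ts \<in> L. cycle_type d (perm_prod ts) = mset \<mu>}) / (fact d * fact r)"
        if "length \<mu> = n" "sum_list \<mu> = d" for \<mu>
      proof -
        have "{ts. length ts = r \<and> (\<forall>s\<in>set ts. is_transp d s) \<and> transitive_gen d ts
              \<and> cycle_type d (perm_prod ts) = mset \<mu>} = {ts \<in> L. cycle_type d (perm_prod ts) = mset \<mu>}"
          by (auto simp: L_def conn_lists_def is_transp_iff transitive_gen_iff)
        then show ?thesis using that r
          by (simp add: hurwitz_H_def hurwitz_h_def Let_def)
      qed
      have "F_diag g n $ d = (\<Sum>\<mu>\<in>{\<mu>. length \<mu> = n \<and> (\<forall>k\<in>set \<mu>. 0 < k) \<and> sum_list \<mu> = d}.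
          real (aut_card \<mu> * card {ts \<in> L. cycle_type d (perm_prod ts) = mset \<mu>}) / (fact d * fact r))"
        unfolding F_diag_def fps_nth_Abs_fps by (intro sum.cong refl H) auto
      also have "\<dots> = real (\<Sum>\<mu>\<in>{\<mu>. length \<mu> = n \<and> (\<forall>k\<in>set \<mu>. 0 < k) \<and> sum_list \<mu> = d}.
          aut_card \<mu> * card {ts \<in> L. cycle_type d (perm_prod ts) = mset \<mu>}) / (fact d * fact r)"
        by (simp add: sum_divide_distrib)
      also have "\<dots> = real (fact n * card {ts \<in> L. sz ts = n}) / (fact d * fact r)"
        using sum_aut_card_cycle_type[of d m n] False unfolding L_def r_def sz_def by (simp only: neq0_conv)
      finally show ?thesis by simp
    qed
    then have "S_H m $ d = (\<Sum>(g, n)\<in>I. real (card {ts \<in> L. sz ts = n}) / (fact d * fact r))"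
      unfolding S by (intro sum.cong) auto
    also have "\<dots> = real (\<Sum>(g, n)\<in>I. card {ts \<in> L. sz ts = n}) / (fact d * fact r)"
      by (simp add: sum_divide_distrib split_def)
    also have "(\<Sum>(g, n)\<in>I. card {ts \<in> L. sz ts = n}) = card L"
    proof -
      \<comment> \<open>The number of cycles determines the genus, so every tuple falls into exactly
        one class \<open>(g, n)\<close>.\<close>
      define gn where "gn ts = ((m + 1 - sz ts) div 2, sz ts)" for ts
      have mem: "gn ts \<in> I" if "ts \<in> L" for ts
        using cycle_type_conn_lists[of ts d m] that False
        by (auto simp: gn_def I_def sz_def L_def r_def)
      have fib: "{ts \<in> L. sz ts = n} = {ts \<in> L. gn ts = (g, n)}" if "(g, n) \<in> I" for g n
        using that by (auto simp: gn_def I_def)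
      have "(\<Sum>(g, n)\<in>I. card {ts \<in> L. sz ts = n}) = (\<Sum>x\<in>I. \<Sum>ts\<in>{ts \<in> L. gn ts = x}. 1)"
        using fib by (intro sum.cong) auto
      also have "\<dots> = (\<Sum>ts\<in>L. 1)" using mem finL finI by (intro sum.group) auto
      finally show ?thesis by simp
    qed
    finally show ?thesis using False by (simp add: diag_def conn_ser_def num_conn_def L_def r_def)
  qed
qed

section \<open>Abel's identity and the tree function\<close>

text \<open>Up to \<open>k!\<close> this is the coefficient of \<open>y^k\<close> in
  \<open>(exp y - 1)^n\<close>, a series that starts at \<open>y^n\<close>.\<close>

lemma alternating_binomial_power_sum:
  assumes "k < n"
  shows "(\<Sum>i\<le>n. real (n choose i) * (-1) ^ (n - i) * real i ^ k) = 0"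
proof -
  have "((fps_exp 1 - 1) ^ n :: real fps) = (\<Sum>i\<le>n. of_nat (n choose i) * fps_exp 1 ^ i * (-1) ^ (n - i))"
    using binomial_ring[of "fps_exp 1" "-1 :: real fps" n] by simp
  also have "\<dots> = (\<Sum>i\<le>n. fps_const (real (n choose i) * (-1) ^ (n - i)) * fps_exp (real i))"
  proof (rule sum.cong[OF refl])
    fix i
    have "(-1 :: real fps) ^ (n - i) = fps_const ((-1) ^ (n - i))"
      by (metis fps_const_1_eq_1 fps_const_neg fps_const_power)
    then show "of_nat (n choose i) * fps_exp 1 ^ i * (-1) ^ (n - i) =
        fps_const (real (n choose i) * (-1) ^ (n - i)) * fps_exp (real i)"
      by (simp add: fps_exp_power_mult fps_of_nat[symmetric] fps_const_mult[symmetric] mult_ac del: fps_const_mult)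
  qed
  finally have "((fps_exp 1 - 1) ^ n :: real fps) $ k = (\<Sum>i\<le>n. real (n choose i) * (-1) ^ (n - i) * (real i ^ k / fact k))"
    by (simp add: fps_sum_nth)
  moreover have "((fps_exp 1 - 1) ^ n :: real fps) $ k = 0"
    using startsby_zero_power_prefix[of "fps_exp 1 - 1 :: real fps" n] assms by simp
  ultimately have "(\<Sum>i\<le>n. real (n choose i) * (-1) ^ (n - i) * real i ^ k) / fact k = 0"
    by (simp add: sum_divide_distrib)
  then show ?thesis by simp
qed

lemma smult_sum_distrib: "smult c (\<Sum>i\<in>I. p i) = (\<Sum>i\<in>I. smult c (p i))"
  by (induction I rule: infinite_finite_induct) (simp_all add: smult_add_right)

text \<open>By induction on \<open>n\<close>: differentiating in the variable reduces
  \<open>n + 1\<close> to \<open>n\<close>, and the constant of integration is found at 0, where the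
  sum is an alternating binomial sum.\<close>

lemma abel_identity:
  "1 \<le> n \<Longrightarrow> (\<Sum>i=1..n. smult (real (n choose i) * real i ^ (i - 1)) ([:- real i, 1:] ^ (n - i))) = monom (real n) (n - 1)"
proof (induction n rule: nat_induct_at_least)
  case base
  then show ?case by (simp add: monom_0 one_pCons)
next
  case (Suc n)
  define A where "A n = (\<Sum>i=1..n. smult (real (n choose i) * real i ^ (i - 1)) ([:- real i, 1:] ^ (n - i)))" for n
  have "pderiv (A (Suc n)) = (\<Sum>i=1..Suc n. smult (real (Suc n choose i) * real i ^ (i - 1))
      (smult (real (Suc n - i)) ([:- real i, 1:] ^ (n - i))))"
    unfolding A_def by (simp add: higher_pderiv_sum[where n = 1, simplified] pderiv_smult pderiv_power pderiv_pCons del: sum.cl_ivl_Suc)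
  also have "\<dots> = (\<Sum>i=1..n. smult (real (Suc n choose i) * real i ^ (i - 1))
      (smult (real (Suc n - i)) ([:- real i, 1:] ^ (n - i))))"
    by simp
  also have "\<dots> = (\<Sum>i=1..n. smult (real (Suc n)) (smult (real (n choose i) * real i ^ (i - 1)) ([:- real i, 1:] ^ (n - i))))"
  proof (rule sum.cong[OF refl])
    fix i
    have "(Suc n - i) * (Suc n choose i) = Suc n * (n choose i)"
      using binomial_absorb_comp[of "Suc n" i] by simp
    then have e: "real (Suc n choose i) * real (Suc n - i) = real (Suc n) * real (n choose i)"
      by (metis mult.commute of_nat_mult)
    have "real (Suc n choose i) * r * real (Suc n - i) = real (Suc n) * (real (n choose i) * r)" for r
      using arg_cong[OF e, of "\<lambda>x. x * r"] by (simp only: mult_ac)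
    then show "smult (real (Suc n choose i) * real i ^ (i - 1)) (smult (real (Suc n - i)) ([:- real i, 1:] ^ (n - i))) =
      smult (real (Suc n)) (smult (real (n choose i) * real i ^ (i - 1)) ([:- real i, 1:] ^ (n - i)))"
      by (simp only: smult_smult)
  qed
  also have "\<dots> = smult (real (Suc n)) (monom (real n) (n - 1))"
    unfolding smult_sum_distrib[symmetric] Suc.IH ..
  also have "\<dots> = pderiv (monom (real (Suc n)) n)"
    by (simp add: pderiv_monom smult_monom)
  finally have "pderiv (A (Suc n) - monom (real (Suc n)) n) = 0" by (simp add: pderiv_diff)
  then obtain c where c: "A (Suc n) - monom (real (Suc n)) n = [:c:]"
    by (metis pderiv_eq_0_iff degree_eq_zeroE)
  have "poly (A (Suc n)) 0 = (\<Sum>i=1..Suc n. real (Suc n choose i) * (-1) ^ (Suc n - i) * real i ^ n)"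
  proof -
    have "real i ^ (i - 1) * (- real i) ^ (Suc n - i) = (-1) ^ (Suc n - i) * real i ^ n" if "i \<in> {1..Suc n}" for i
    proof -
      have "(- real i) ^ (Suc n - i) = (-1) ^ (Suc n - i) * real i ^ (Suc n - i)" by (rule power_minus)
      moreover have "real i ^ (i - 1) * real i ^ (Suc n - i) = real i ^ n"
        using that by (simp add: power_add[symmetric])
      ultimately show ?thesis by (metis mult.left_commute)
    qed
    then show ?thesis unfolding A_def
      by (simp only: poly_sum poly_smult poly_power) (auto intro!: sum.cong simp: mult.assoc)
  qed
  \<comment> \<open>The added term \<open>i = 0\<close> is zero because \<open>n\<close> is
    positive.\<close>
  also have "\<dots> = (\<Sum>i\<le>Suc n. real (Suc n choose i) * (-1) ^ (Suc n - i) * real i ^ n)"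
    using Suc.hyps by (intro sum.mono_neutral_left) auto
  also have "\<dots> = 0" by (rule alternating_binomial_power_sum) simp
  finally have "poly (A (Suc n)) 0 = 0" .
  moreover have "poly (monom (real (Suc n)) n) 0 = 0" using Suc.hyps by (simp add: poly_monom)
  ultimately have "c = 0" using arg_cong[OF c, of "\<lambda>p. poly p 0"] by simp
  then show ?case using c by (simp add: A_def)
qed

text \<open>The exponential generating function of rooted labelled trees, that is, the solution
  \<open>z\<close> of \<open>x = z exp (-z)\<close>.\<close>

definition tree_ser :: "real fps" where
  "tree_ser = Abs_fps (\<lambda>k. if k = 0 then 0 else real k ^ (k - 1) / fact k)"

lemma t_ser_eq: "t_ser = 1 + xD tree_ser"
proof (rule fps_ext)
  fix n show "t_ser $ n = (1 + xD tree_ser) $ n"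
    by (cases n) (simp_all add: t_ser_def tree_ser_def)
qed

text \<open>The relation \<open>t = 1 / (1 - z)\<close>. The coefficient of
  \<open>tree_ser * t_ser\<close> is Abel's sum evaluated at \<open>n\<close>, which is
  \<open>n * n^(n - 1)\<close>, so it agrees with that of \<open>t_ser\<close> for positive
  \<open>n\<close>.\<close>

lemma t_ser_tree: "t_ser * (1 - tree_ser) = 1"
proof (rule fps_ext)
  fix n :: nat
  have t: "t_ser $ k = real k ^ k / fact k" for k by (cases k) (simp_all add: t_ser_def)
  show "(t_ser * (1 - tree_ser)) $ n = 1 $ n"
  proof (cases "n = 0")
    case True
    then show ?thesis by (simp add: t_ser_def tree_ser_def)
  next
    case False
    have "(tree_ser * t_ser) $ n = (\<Sum>i=0..n. tree_ser $ i * t_ser $ (n - i))" by (simp add: fps_mult_nth)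
    also have "\<dots> = (\<Sum>i=1..n. tree_ser $ i * t_ser $ (n - i))"
      by (rule sum.mono_neutral_right) (auto simp: tree_ser_def)
    also have "\<dots> = (\<Sum>i=1..n. real (n choose i) * real i ^ (i - 1) * (real n - real i) ^ (n - i) / fact n)"
    proof (rule sum.cong[OF refl])
      fix i assume "i \<in> {1..n}"
      moreover from this have "real (n choose i) = fact n / (fact i * fact (n - i))" by (simp add: binomial_fact)
      ultimately show "tree_ser $ i * t_ser $ (n - i) = real (n choose i) * real i ^ (i - 1) * (real n - real i) ^ (n - i) / fact n"
        by (simp add: t tree_ser_def of_nat_diff)
    qed
    also have "\<dots> = poly (\<Sum>i=1..n. smult (real (n choose i) * real i ^ (i - 1)) ([:- real i, 1:] ^ (n - i))) (real n) / fact n"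
      by (simp add: poly_sum poly_power sum_divide_distrib)
    also have "\<dots> = real n ^ n / fact n"
      using False by (subst abel_identity) (simp_all add: poly_monom power_eq_if[of _ n])
    finally show ?thesis using False by (simp add: right_diff_distrib t mult.commute[of t_ser])
  qed
qed

section \<open>Polynomials in t\<close>

lemma xD_add: "xD (f + g) = xD f + xD g"
  and xD_uminus: "xD (- f) = - xD f"
  and xD_diff: "xD (f - g) = xD f - xD g"
  and xD_mult: "xD (f * g) = xD f * g + f * xD g"
  and xD_const: "xD (fps_const c) = 0"
  and xD_const_mult: "xD (fps_const c * f) = fps_const c * xD f"
  by (simp_all add: xD_def algebra_simps)

text \<open>The coefficient at \<open>n\<close> appears with factor \<open>n - 1\<close> and is
  otherwise determined by lower ones; hence the coefficient at 1 must be prescribed.\<close>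

lemma tree_equation_unique:
  assumes "xD f = f + f * xD f" "xD g = g + g * xD g" "f $ 0 = 0" "g $ 0 = 0" "f $ 1 = g $ 1"
  shows "f = g"
proof (rule fps_ext)
  fix n
  show "f $ n = g $ n"
  proof (induction n rule: less_induct)
    case (less n)
    have *: "(real n - 1) * h $ n = (\<Sum>i\<in>{0<..<n}. h $ i * (real (n - i) * h $ (n - i)))"
      if h: "xD h = h + h * xD h" "h $ 0 = 0" for h
    proof -
      have "real n * h $ n = h $ n + (\<Sum>i=0..n. h $ i * (real (n - i) * h $ (n - i)))"
        using arg_cong[OF h(1), of "\<lambda>f. f $ n"] by (simp add: fps_mult_nth)
      also have "(\<Sum>i=0..n. h $ i * (real (n - i) * h $ (n - i))) = (\<Sum>i\<in>{0<..<n}. h $ i * (real (n - i) * h $ (n - i)))"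
        using h(2) by (intro sum.mono_neutral_right) (auto simp: not_less)
      finally show ?thesis by (simp add: algebra_simps)
    qed
    consider "n = 0" | "n = 1" | "2 \<le> n" by linarith
    then show ?case
    proof cases
      case 3
      have "(real n - 1) * f $ n = (real n - 1) * g $ n"
        unfolding *[OF assms(1,3)] *[OF assms(2,4)] using less by (intro sum.cong) auto
      then show ?thesis using 3 by simp
    qed (use assms in auto)
  qed
qed

text \<open>For the difference of two solutions the coefficient at \<open>n\<close> has factor
  \<open>m + n\<close>, nonzero even at \<open>n = 0\<close> as \<open>m\<close> is positive, and
  depends only on lower coefficients.\<close>

lemma linear_equation_unique:
  assumes eq: "of_nat m * f + (1 - u) * xD f = of_nat m * g + (1 - u) * xD g" and "0 < m" "u $ 0 = 0"
  shows "f = g"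
proof -
  define h where "h = f - g"
  have h: "of_nat m * h + xD h = u * xD h"
    using eq by (simp add: h_def xD_diff algebra_simps)
  have "h $ n = 0" for n
  proof (induction n rule: less_induct)
    case (less n)
    have "(real m + real n) * h $ n = (\<Sum>i=0..n. u $ i * (real (n - i) * h $ (n - i)))"
      using arg_cong[OF h, of "\<lambda>f. f $ n"] by (simp add: fps_mult_nth[of u] fps_of_nat[symmetric] algebra_simps)
    also have "\<dots> = 0"
    proof (rule sum.neutral, rule ballI)
      fix i assume "i \<in> {0..n}"
      show "u $ i * (real (n - i) * h $ (n - i)) = 0"
        using less[of "n - i"] \<open>u $ 0 = 0\<close> \<open>i \<in> {0..n}\<close> by (cases "i = 0") auto
    qed
    finally show ?case using \<open>0 < m\<close> by simp
  qed
  then have "h = 0" by (intro fps_ext) simp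
  then show ?thesis by (simp add: h_def)
qed

section \<open>Evaluation at \<open>t_ser\<close> and exact degrees\<close>

definition ev :: "real poly \<Rightarrow> real fps" where
  "ev p = poly (map_poly fps_const p) t_ser"

lemma ev_0 [simp]: "ev 0 = 0" by (simp add: ev_def)

lemma ev_pCons [simp]: "ev (pCons a p) = fps_const a + t_ser * ev p"
  by (simp add: ev_def map_poly_pCons)

lemma ev_add: "ev (p + q) = ev p + ev q"
  by (induction p q rule: poly_induct2) (simp_all add: algebra_simps flip: fps_const_add)

lemma ev_smult: "ev (smult c p) = fps_const c * ev p"
  by (induction p) (simp_all add: algebra_simps flip: fps_const_mult)

lemma ev_mult: "ev (p * q) = ev p * ev q"
  by (induction p) (simp_all add: ev_add ev_smult algebra_simps)

lemma ev_sum: "ev (\<Sum>i\<in>I. p i) = (\<Sum>i\<in>I. ev (p i))"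
  by (induction I rule: infinite_finite_induct) (simp_all add: ev_add)

lemma ev_nth_0: "ev p $ 0 = poly p 1"
  by (induction p) (simp_all add: t_ser_def)

text \<open>Differentiate \<open>t (1 - z) = 1\<close> and insert
  \<open>xD z = t - 1\<close>.\<close>

lemma xD_t_ser: "xD t_ser = t_ser ^ 2 * (t_ser - 1)"
proof -
  have "xD (t_ser * (1 - tree_ser)) = xD (fps_const 1)" by (simp add: t_ser_tree)
  then have "xD t_ser * (1 - tree_ser) = t_ser * xD tree_ser"
    by (simp add: xD_mult xD_diff xD_const del: fps_const_1_eq_1) (simp add: xD_def)
  then have "t_ser * (1 - tree_ser) * xD t_ser = t_ser ^ 2 * xD tree_ser"
    by (simp add: power2_eq_square mult_ac)
  then have "xD t_ser = t_ser ^ 2 * xD tree_ser" by (simp add: t_ser_tree)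
  moreover have "xD tree_ser = t_ser - 1" by (simp add: t_ser_eq)
  ultimately show ?thesis by simp
qed

text \<open>The operator \<open>x d/dx\<close> carried over to polynomials in \<open>t\<close>; the
  cubic is \<open>t^2 (t - 1)\<close>.\<close>

definition pD :: "real poly \<Rightarrow> real poly" where
  "pD p = [:0, 0, -1, 1:] * pderiv p"

lemma ev_cubic: "ev [:0, 0, -1, 1:] = xD t_ser"
  by (simp add: xD_t_ser power2_eq_square algebra_simps flip: fps_const_neg)

lemma xD_ev: "xD (ev p) = ev (pD p)"
proof (induction p)
  case 0
  then show ?case by (simp add: pD_def xD_def)
next
  case (pCons a p)
  have "ev (pD (pCons a p)) = xD t_ser * (ev p + t_ser * ev (pderiv p))"
    unfolding pD_def ev_mult pderiv_pCons ev_add ev_cubic by simp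
  also have "\<dots> = xD t_ser * ev p + t_ser * xD (ev p)"
    unfolding pCons.IH pD_def ev_mult ev_cubic by (simp add: algebra_simps)
  finally show ?case by (simp add: xD_add xD_mult xD_const)
qed

lemma degree_pD_le: "degree (pD p) \<le> degree p + 2"
proof (cases "pderiv p = 0")
  case True
  then show ?thesis by (simp add: pD_def)
next
  case False
  then have "degree p \<noteq> 0" by (simp add: pderiv_eq_0_iff)
  have "degree (pD p) \<le> degree [:0, 0, -1, 1 :: real:] + degree (pderiv p)"
    unfolding pD_def by (rule degree_mult_le)
  then show ?thesis using degree_pderiv[of p] \<open>degree p \<noteq> 0\<close> by simp
qed

text \<open>Positivity excludes cancellation of leading terms in sums, so degrees come out exactly
  and not only as bounds.\<close>

definition pos_lead :: "nat \<Rightarrow> real poly \<Rightarrow> bool" where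
  "pos_lead N p \<longleftrightarrow> degree p = N \<and> 0 < coeff p N"

lemma pos_leadI: "degree p \<le> N \<Longrightarrow> 0 < coeff p N \<Longrightarrow> pos_lead N p"
  using le_degree[of p N] by (auto simp: pos_lead_def)

lemma pos_lead_add: "pos_lead N p \<Longrightarrow> pos_lead N q \<Longrightarrow> pos_lead N (p + q)"
  by (intro pos_leadI) (auto simp: pos_lead_def degree_add_le)

lemma pos_lead_smult: "pos_lead N p \<Longrightarrow> 0 < c \<Longrightarrow> pos_lead N (smult c p)"
  by (auto simp: pos_lead_def)

lemma pos_lead_mult:
  assumes "pos_lead N p" "pos_lead M q"
  shows "pos_lead (N + M) (p * q)"
proof -
  have "p \<noteq> 0" "q \<noteq> 0" using assms by (auto simp: pos_lead_def)
  then have "degree (p * q) = N + M" using assms by (simp add: degree_mult_eq pos_lead_def)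
  moreover have "coeff (p * q) (N + M) = coeff p N * coeff q M"
    using assms coeff_mult_degree_sum[of p q] by (simp add: pos_lead_def)
  ultimately show ?thesis using assms by (simp add: pos_lead_def)
qed

lemma pos_lead_sum:
  "finite I \<Longrightarrow> I \<noteq> {} \<Longrightarrow> (\<And>i. i \<in> I \<Longrightarrow> pos_lead N (p i)) \<Longrightarrow> pos_lead N (\<Sum>i\<in>I. p i)"
  by (induction I rule: finite_ne_induct) (auto intro: pos_lead_add)

lemma pos_lead_pD:
  assumes "pos_lead N p" "0 < N"
  shows "pos_lead (N + 2) (pD p)"
proof -
  have "pos_lead (N - 1) (pderiv p)"
    using assms by (intro pos_leadI) (auto simp: pos_lead_def degree_pderiv coeff_pderiv)
  then have "pos_lead (3 + (N - 1)) (pD p)"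
    unfolding pD_def by (intro pos_lead_mult) (simp_all add: pos_lead_def numeral_3_eq_3)
  then show ?thesis using assms(2) by (simp add: numeral_3_eq_3)
qed

text \<open>Differentiation loses at most one factor \<open>t\<close> and the cubic supplies
  two.\<close>

lemma X_power_dvd_pD:
  assumes "[:0, 1:] ^ k dvd p"
  shows "[:0, 1:] ^ (k + 1) dvd pD p"
proof -
  obtain v where v: "p = [:0, 1:] ^ k * v" using assms by (auto elim: dvdE)
  have c: "[:0, 0, -1, 1 :: real:] = [:0, 1:] * ([:0, 1:] * [:-1, 1:])" by simp
  show ?thesis
  proof (cases k)
    case 0
    then show ?thesis unfolding pD_def c by (intro dvd_mult2) simp
  next
    case (Suc j)
    have "pderiv p = [:0, 1:] ^ j * (smult (real k) v + [:0, 1:] * pderiv v)"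
      unfolding v Suc pderiv_mult pderiv_power_Suc by (simp add: pderiv_pCons algebra_simps)
    then have "pD p = [:0, 1:] ^ (k + 1) * ([:-1, 1:] * (smult (real k) v + [:0, 1:] * pderiv v))"
      unfolding pD_def c Suc by (simp only: power_add power_Suc power_one_right mult_ac power_0)
    then show ?thesis by (metis dvd_triv_left)
  qed
qed

text \<open>In the basis of powers of \<open>t - 1\<close> the operator is diagonal with eigenvalues \<open>m + k\<close>.\<close>

lemma euler_operator_surj:
  assumes "0 < m"
  shows "degree Q \<le> N \<Longrightarrow> \<exists>q. degree q \<le> N \<and> smult (real m) q + [:-1, 1:] * pderiv q = Q"
proof (induction N arbitrary: Q)
  case 0
  then obtain c where "Q = [:c:]" by (metis degree_eq_zeroE le_zero_eq)
  then show ?case using assms by (intro exI[of _ "[:c / real m:]"]) simp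
next
  case (Suc N)
  define L where "L q = smult (real m) q + [:-1, 1:] * pderiv q" for q :: "real poly"
  \<comment> \<open>On degree \<open>Suc N\<close> the operator multiplies the leading coefficient
    by \<open>m + Suc N\<close>, so the image of this monomial cancels the top term of
    \<open>Q\<close>.\<close>
  define r where "r = monom (coeff Q (Suc N) / (real m + real (Suc N))) (Suc N)"
  have "coeff (L r) k = (real m + real k) * coeff r k - real (Suc k) * coeff r (Suc k)" for k
    by (cases k) (simp_all add: L_def coeff_pderiv algebra_simps)
  then have "coeff (L r) (Suc N) = coeff Q (Suc N)" "\<And>k. Suc N < k \<Longrightarrow> coeff (L r) k = 0"
    using assms by (auto simp: r_def)
  then have "degree (Q - L r) \<le> N"
    using Suc.prems by (intro degree_le) (auto simp: coeff_eq_0 Suc_le_eq[symmetric] le_Suc_eq dest!: le_imp_less_or_eq)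
  from Suc.IH[OF this] obtain q where q: "degree q \<le> N" "L q = Q - L r" by (auto simp: L_def)
  have "L (q + r) = L q + L r" by (simp add: L_def pderiv_add smult_add_right algebra_simps)
  then have "L (q + r) = Q" using q by simp
  moreover have "degree (q + r) \<le> Suc N" using q by (intro degree_add_le) (auto simp: r_def degree_monom_le)
  ultimately show ?case unfolding L_def by blast
qed

lemma euler_operator_surj_pos_lead:
  assumes "0 < m" "pos_lead N Q"
  shows "\<exists>q. pos_lead N q \<and> smult (real m) q + [:-1, 1:] * pderiv q = Q"
proof -
  obtain q where q: "degree q \<le> N" "smult (real m) q + [:-1, 1:] * pderiv q = Q"
    using euler_operator_surj[OF assms(1), of Q N] assms(2) by (auto simp: pos_lead_def)
  have "coeff Q N = (real m + real N) * coeff q N"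
    using q(1) unfolding q(2)[symmetric] by (cases N) (simp_all add: coeff_pderiv coeff_eq_0 algebra_simps)
  then have "0 < coeff q N" using assms by (auto simp: pos_lead_def zero_less_mult_iff)
  then show ?thesis using q pos_leadI by blast
qed

section \<open>Polynomiality\<close>

text \<open>The gauge factor \<open>exp (d y / 2)\<close> allows loops of weight one half; it removes the first-order
  term of the recursion, and only then are the solutions visibly divisible by powers of \<open>t\<close>.\<close>

definition loop_ser :: "nat \<Rightarrow> real fps" where
  "loop_ser m = diag (gauge (1/2) conn_ser) m"

lemma cut_join_loops: "cut_join 0 (gauge (1/2) conn_ser)"
  using cut_join_gauge[OF cut_join_conn_ser, of "1/2"] by simp

lemma loop_ser_rec:
  "of_nat m * loop_ser (m + 1) + xD (loop_ser (m + 1)) =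
     fps_const (1/2) * (xD (xD (loop_ser m)) + (\<Sum>a\<le>m + 1. xD (loop_ser a) * xD (loop_ser (m + 1 - a))))"
  using diag_rec[OF cut_join_loops, of m] by (simp add: loop_ser_def)

text \<open>Applying \<open>xD\<close> to the quadratic relation for \<open>loop_ser 0\<close> gives
  a differential equation for \<open>u = xD (loop_ser 0)\<close> alone. The relation
  \<open>t (1 - z) = 1\<close> is the same equation for \<open>tree_ser\<close>, and both series
  start with \<open>x\<close>.\<close>

lemma xD_loop_ser_0: "xD (loop_ser 0) = tree_ser"
proof (rule tree_equation_unique)
  define u where "u = xD (loop_ser 0)"
  have "u - loop_ser 0 = fps_const (1/2) * u ^ 2"
    using diag_rec_0[OF cut_join_loops] by (simp add: u_def loop_ser_def)
  then have "xD (u - loop_ser 0) = xD (fps_const (1/2) * (u * u))" by (simp add: power2_eq_square)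
  then have "xD u - u = fps_const (1/2) * (xD u * u + u * xD u)"
    unfolding xD_const_mult xD_diff xD_mult[of u] u_def[symmetric] .
  also have "\<dots> = u * xD u"
    unfolding mult.commute[of "xD u" u] by (rule fps_ext) (simp only: fps_mult_left_const_nth fps_add_nth, simp)
  finally show "xD (xD (loop_ser 0)) = xD (loop_ser 0) + xD (loop_ser 0) * xD (xD (loop_ser 0))"
    by (simp add: u_def algebra_simps)
  have "(1 + xD tree_ser) * (1 - tree_ser) = 1" using t_ser_tree by (simp add: t_ser_eq)
  then show "xD tree_ser = tree_ser + tree_ser * xD tree_ser" by (simp add: algebra_simps)
  show "xD (loop_ser 0) $ 0 = 0" "tree_ser $ 0 = 0" by (simp_all add: tree_ser_def)
  show "xD (loop_ser 0) $ 1 = tree_ser $ 1"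
    by (simp add: loop_ser_def diag_def gauge_def conn_ser_def num_conn_0 tree_ser_def)
qed

text \<open>The end terms \<open>a = 0\<close> and \<open>a = m + 1\<close> are the only ones
  containing the unknown. Together they give \<open>tree_ser * xD (loop_ser (m + 1))\<close>, which
  moves to the left and leaves the factor \<open>1 - tree_ser = 1 / t\<close>.\<close>

lemma loop_ser_rec_linear:
  "of_nat m * loop_ser (m + 1) + (1 - tree_ser) * xD (loop_ser (m + 1)) =
     fps_const (1/2) * (xD (xD (loop_ser m)) + (\<Sum>a=1..m. xD (loop_ser a) * xD (loop_ser (m + 1 - a))))"
proof -
  define D where "D a = xD (loop_ser a) * xD (loop_ser (m + 1 - a))" for a
  have "(\<Sum>a\<le>m + 1. D a) = D 0 + D (m + 1) + (\<Sum>a=1..m. D a)"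
    by (simp add: sum.atLeast_Suc_atMost sum.atLeast1_atMost_eq atMost_atLeast0 sum.atLeast0_atMost_Suc)
  also have "D 0 + D (m + 1) = fps_const 2 * (tree_ser * xD (loop_ser (m + 1)))"
    by (simp add: D_def xD_loop_ser_0 mult.commute[of _ tree_ser] fps_numeral_fps_const[symmetric])
  finally have s: "(\<Sum>a\<le>m + 1. D a) = fps_const 2 * (tree_ser * xD (loop_ser (m + 1))) + (\<Sum>a=1..m. D a)" .
  have h: "fps_const (1/2) * (fps_const 2 * f) = f" for f :: "real fps"
    by (simp add: mult.assoc[symmetric])
  have "of_nat m * loop_ser (m + 1) + xD (loop_ser (m + 1)) =
     fps_const (1/2) * (xD (xD (loop_ser m)) + (fps_const 2 * (tree_ser * xD (loop_ser (m + 1))) + (\<Sum>a=1..m. D a)))"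
    using loop_ser_rec[of m] unfolding D_def[symmetric] s .
  then show ?thesis unfolding D_def[symmetric] by (simp only: distrib_left h) (simp add: algebra_simps)
qed

text \<open>For \<open>m = 0\<close> the zeroth-order term is absent and only the derivative is
  found. Indeed \<open>loop_ser 1\<close> is \<open>(log t) / 2\<close>, not a polynomial, while its
  derivative is \<open>t (t - 1) / 2\<close>.\<close>

lemma xD_loop_ser_1: "xD (loop_ser 1) = ev [:0, - 1/2, 1/2:]"
proof -
  have "(1 - tree_ser) * xD (loop_ser 1) = fps_const (1/2) * xD tree_ser"
    using loop_ser_rec_linear[of 0] by (simp add: xD_loop_ser_0)
  then have "t_ser * (1 - tree_ser) * xD (loop_ser 1) = t_ser * (fps_const (1/2) * xD tree_ser)"
    by (simp only: mult.assoc)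
  also have "xD tree_ser = t_ser - 1" by (simp add: t_ser_eq)
  finally have "xD (loop_ser 1) = t_ser * (fps_const (1/2) * (t_ser - 1))" by (simp add: t_ser_tree)
  also have "\<dots> = ev [:0, - 1/2, 1/2:]"
  proof -
    have c: "fps_const (- 1/2) = - fps_const (1/2 :: real)" by simp
    show ?thesis unfolding ev_pCons ev_0 c by (simp add: algebra_simps del: fps_const_neg)
  qed
  finally show ?thesis .
qed

text \<open>The induction carries the derivatives, since the recursion involves only these and they
  are polynomial from \<open>m = 1\<close> on. Divisibility by \<open>t^m\<close> is what allows the
  equation to be solved at the next step.\<close>

lemma loop_ser_poly:
  "1 \<le> m \<Longrightarrow> (\<exists>w. xD (loop_ser m) = ev w \<and> [:0, 1:] ^ m dvd w \<and> pos_lead (3 * m - 1) w) \<and>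
     (2 \<le> m \<longrightarrow> (\<exists>p. loop_ser m = ev p \<and> pos_lead (3 * m - 3) p))"
proof (induction m rule: less_induct)
  case (less m)
  show ?case
  proof (cases "m = 1")
    case True
    have "[:0, 1:] ^ 1 dvd [:0, - 1/2, 1/2 :: real:]"
      by (rule dvdI[of _ _ "[:- 1/2, 1/2:]"]) simp
    moreover have "pos_lead 2 [:0, - 1/2, 1/2:]" by (simp add: pos_lead_def numeral_2_eq_2)
    ultimately have "\<exists>w. xD (loop_ser 1) = ev w \<and> [:0, 1:] ^ 1 dvd w \<and> pos_lead 2 w"
      using xD_loop_ser_1 by blast
    then show ?thesis using True by simp
  next
    case False
    define n where "n = m - 1"
    have n: "m = n + 1" "1 \<le> n" using False less.prems by (auto simp: n_def)
    have "\<forall>a\<in>{1..n}. \<exists>w. xD (loop_ser a) = ev w \<and> [:0, 1:] ^ a dvd w \<and> pos_lead (3 * a - 1) w"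
      using less.IH n by auto
    then obtain w where w: "\<And>a. a \<in> {1..n} \<Longrightarrow> xD (loop_ser a) = ev (w a)"
        "\<And>a. a \<in> {1..n} \<Longrightarrow> [:0, 1:] ^ a dvd w a" "\<And>a. a \<in> {1..n} \<Longrightarrow> pos_lead (3 * a - 1) (w a)"
      by metis
    define R where "R = smult (1/2) (pD (w n) + (\<Sum>a=1..n. w a * w (n + 1 - a)))"
    have evR: "of_nat n * loop_ser (n + 1) + (1 - tree_ser) * xD (loop_ser (n + 1)) = ev R"
    proof -
      have "(\<Sum>a=1..n. xD (loop_ser a) * xD (loop_ser (n + 1 - a))) = (\<Sum>a=1..n. ev (w a * w (n + 1 - a)))"
      proof (rule sum.cong[OF refl])
        fix a assume "a \<in> {1..n}"
        then have "a \<in> {1..n}" "n + 1 - a \<in> {1..n}" by auto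
        then show "xD (loop_ser a) * xD (loop_ser (n + 1 - a)) = ev (w a * w (n + 1 - a))"
          by (simp only: w(1) ev_mult)
      qed
      moreover have "xD (xD (loop_ser n)) = ev (pD (w n))" using w(1)[of n] n(2) by (simp add: xD_ev)
      ultimately show ?thesis unfolding loop_ser_rec_linear by (simp add: R_def ev_smult ev_add ev_sum)
    qed
    have "[:0, 1:] ^ (n + 1) dvd w a * w (n + 1 - a)" if "a \<in> {1..n}" for a
    proof -
      have "[:0, 1:] ^ (n + 1) = [:0, 1 :: real:] ^ a * [:0, 1:] ^ (n + 1 - a)"
        using that by (simp add: power_add[symmetric] del: power_Suc)
      moreover have "n + 1 - a \<in> {1..n}" using that by auto
      ultimately show ?thesis using w(2)[of a] w(2)[of "n + 1 - a"] that by (simp only: mult_dvd_mono)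
    qed
    then have "[:0, 1:] ^ (n + 1) dvd R"
      unfolding R_def using X_power_dvd_pD[OF w(2)[of n]] n(2)
      by (intro dvd_smult dvd_add dvd_sum) auto
    then obtain Q where Q: "R = [:0, 1:] ^ (n + 1) * Q" by (auto elim: dvdE)
    have "pos_lead (3 * n + 1) (w a * w (n + 1 - a))" if "a \<in> {1..n}" for a
    proof -
      have "3 * a - 1 + (3 * (n + 1 - a) - 1) = 3 * n + 1" using that by auto
      moreover have "n + 1 - a \<in> {1..n}" using that by auto
      ultimately show ?thesis using pos_lead_mult[OF w(3)[of a] w(3)[of "n + 1 - a"]] that by simp
    qed
    moreover have "pos_lead (3 * n + 1) (pD (w n))"
    proof -
      have "3 * n - 1 + 2 = 3 * n + 1" "0 < 3 * n - 1" using n(2) by auto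
      then show ?thesis using pos_lead_pD[OF w(3)[of n]] n(2) by simp
    qed
    ultimately have R: "pos_lead (3 * n + 1) R"
      unfolding R_def using n(2) by (intro pos_lead_smult pos_lead_add pos_lead_sum) auto
    have X: "degree ([:0, 1 :: real:] ^ k) = k" "coeff ([:0, 1 :: real:] ^ k) k = 1" for k
      using lead_coeff_power[of "[:0, 1 :: real:]" k] by (simp_all add: degree_power_eq)
    have Q': "pos_lead (2 * n) Q"
    proof -
      have "Q \<noteq> 0" using R Q by (auto simp: pos_lead_def)
      then have "degree R = n + 1 + degree Q" unfolding Q by (subst degree_mult_eq) (simp_all only: X, auto)
      then have d: "degree Q = 2 * n" using R by (simp add: pos_lead_def)
      then have "coeff R (3 * n + 1) = coeff Q (2 * n)"
        using coeff_mult_degree_sum[of "[:0, 1:] ^ (n + 1)" Q] unfolding Q X by (simp add: X algebra_simps del: power_Suc)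
      then show ?thesis using d R by (simp add: pos_lead_def)
    qed
    obtain q where q: "pos_lead (2 * n) q" "smult (real n) q + [:-1, 1:] * pderiv q = Q"
      using euler_operator_surj_pos_lead[OF _ Q', of n] n(2) by auto
    \<comment> \<open>The substitution \<open>p = t^n q\<close> turns
      \<open>n p + t (t - 1) p'\<close> into \<open>t^(n+1) (n q + (t - 1) q')\<close>, so a common
      power of \<open>t\<close> cancels. The degree is \<open>n + 2 n = 3 m - 3\<close>.\<close>
    define p where "p = [:0, 1:] ^ n * q"
    have p: "pos_lead (3 * n) p"
    proof -
      have "pos_lead n ([:0, 1:] ^ n)" using X by (simp add: pos_lead_def)
      from pos_lead_mult[OF this q(1)] show ?thesis by (simp add: p_def)
    qed
    have "smult (real n) p + [:0, 1:] * [:-1, 1:] * pderiv p = R"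
    proof -
      obtain k where k: "n = Suc k" using n(2) by (cases n) auto
      have "pderiv p = smult (real n) ([:0, 1:] ^ k * q) + [:0, 1:] ^ n * pderiv q"
        unfolding p_def k pderiv_mult pderiv_power_Suc by (simp add: pderiv_pCons algebra_simps)
      then have "[:0, 1:] * [:-1, 1:] * pderiv p =
          [:0, 1:] ^ n * (smult (real n) ([:-1, 1:] * q)) + [:0, 1:] ^ (n + 1) * ([:-1, 1:] * pderiv q)"
        unfolding k by (simp only: distrib_left mult_smult_right power_Suc power_add mult_ac power_one_right power_0)
      moreover have "smult (real n) ([:-1, 1:] * q) = [:0, 1:] * smult (real n) q - smult (real n) q"
        by (simp add: smult_diff_right)
      moreover have "smult (real n) p = [:0, 1:] ^ n * smult (real n) q" by (simp add: p_def)
      moreover have "[:0, 1:] ^ (n + 1) = [:0, 1:] * [:0, 1 :: real:] ^ n" by simp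
      \<comment> \<open>Used with \<open>X = t\<close>, \<open>Y = t^n\<close>,
        \<open>A = n q\<close> and \<open>B = (t - 1) q'\<close>.\<close>
      moreover have "Y * A + (Y * (X * A - A) + X * Y * B) = X * Y * (A + B)" for X Y A B :: "real poly"
        by (simp add: algebra_simps)
      ultimately show ?thesis unfolding Q q(2)[symmetric] by (simp only:)
    qed
    then have "ev R = of_nat n * ev p + ev ([:0, 1:] * [:-1, 1:] * pderiv p)"
      by (metis ev_add ev_smult fps_of_nat)
    also have "ev ([:0, 1:] * [:-1, 1:] * pderiv p) = (1 - tree_ser) * xD (ev p)"
    proof -
      have "xD (ev p) = ev ([:0, 1:] * ([:0, 1:] * [:-1, 1:] * pderiv p))"
        unfolding xD_ev pD_def by (simp add: algebra_simps)
      also have "\<dots> = t_ser * ev ([:0, 1:] * [:-1, 1:] * pderiv p)" by (subst ev_mult) simp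
      finally have "(1 - tree_ser) * xD (ev p) = (t_ser * (1 - tree_ser)) * ev ([:0, 1:] * [:-1, 1:] * pderiv p)"
        by (simp only: mult_ac)
      then show ?thesis by (simp add: t_ser_tree)
    qed
    finally have "of_nat n * loop_ser m + (1 - tree_ser) * xD (loop_ser m) = of_nat n * ev p + (1 - tree_ser) * xD (ev p)"
      using evR n(1) by simp
    then have Tp: "loop_ser m = ev p"
      by (rule linear_equation_unique) (use n(2) in \<open>auto simp: tree_ser_def\<close>)
    moreover have "[:0, 1:] ^ m dvd pD p" using X_power_dvd_pD[of n p] n(1) by (simp add: p_def)
    moreover have "pos_lead (3 * m - 1) (pD p)" using pos_lead_pD[OF p] n by (simp add: algebra_simps)
    ultimately show ?thesis using p n xD_ev[of p] by auto
  qed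
qed

section \<open>Removing the gauge factor\<close>

lemma xD_funpow_nth: "(xD ^^ j) f $ d = real d ^ j * f $ d"
  by (induction j) simp_all

lemma xD_funpow_ev: "(xD ^^ j) (ev p) = ev ((pD ^^ j) p)"
  by (induction j) (simp_all add: xD_ev)

lemma degree_pD_funpow_le: "degree ((pD ^^ j) p) \<le> degree p + 2 * j"
proof (induction j)
  case (Suc j)
  then show ?case using degree_pD_le[of "(pD ^^ j) p"] by simp
qed simp

text \<open>Multiply by \<open>exp (- d y / 2)\<close>. The power \<open>d^j\<close> acts as
  \<open>xD\<close> applied \<open>j\<close> times, and using \<open>y^j\<close> for the exponential
  leaves \<open>j\<close> fewer edges, so \<open>m\<close> drops by \<open>j\<close>. Terms with
  \<open>j > m\<close> leave too few edges to connect \<open>d\<close> points.\<close>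

lemma diag_conn_ser_eq:
  "diag conn_ser m = (\<Sum>j\<le>m. fps_const ((- 1/2) ^ j / fact j) * (xD ^^ j) (loop_ser (m - j)))"
proof (rule fps_ext)
  fix d
  show "diag conn_ser m $ d = (\<Sum>j\<le>m. fps_const ((- 1/2) ^ j / fact j) * (xD ^^ j) (loop_ser (m - j))) $ d"
  proof (cases "d = 0")
    case True
    then show ?thesis by (simp add: diag_def loop_ser_def fps_sum_nth xD_funpow_nth)
  next
    case False
    define G where "G = gauge (1/2) conn_ser d"
    define r where "r = d + m - 1"
    have "fps_exp (- (1/2 * real d)) * fps_exp (1/2 * real d) = 1"
      by (simp add: fps_exp_add_mult[symmetric])
    then have "conn_ser d = fps_exp (- (1/2 * real d)) * G"
      by (simp add: G_def gauge_def mult.assoc[symmetric])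
    then have "conn_ser d $ r = (\<Sum>j=0..r. (- (1/2 * real d)) ^ j / fact j * G $ (r - j))"
      by (simp add: fps_mult_nth)
    also have "\<dots> = (\<Sum>j\<le>m. (- (1/2 * real d)) ^ j / fact j * G $ (r - j))"
    proof (cases "m \<le> r")
      case True
      have "G $ (r - j) = 0" if "j \<in> {0..r} - {..m}" for j
        using cut_join_loops that unfolding cut_join_def G_def r_def by auto
      then show ?thesis using True by (intro sum.mono_neutral_right) auto
    next
      case 2: False
      then show ?thesis using False by (simp add: r_def)
    qed
    also have "\<dots> = (\<Sum>j\<le>m. (- 1/2) ^ j / fact j * (real d ^ j * loop_ser (m - j) $ d))"
    proof (rule sum.cong[OF refl])
      fix j assume "j \<in> {..m}"
      then have "r - j = d + (m - j) - 1" using False by (simp add: r_def)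
      then have "G $ (r - j) = loop_ser (m - j) $ d" using False by (simp add: loop_ser_def diag_def G_def)
      moreover have "(- (1/2 * real d)) ^ j = (- 1/2) ^ j * real d ^ j"
        by (simp flip: power_mult_distrib)
      ultimately show "(- (1/2 * real d)) ^ j / fact j * G $ (r - j) = (- 1/2) ^ j / fact j * (real d ^ j * loop_ser (m - j) $ d)"
        by simp
    qed
    finally show ?thesis using False by (simp add: diag_def r_def fps_sum_nth xD_funpow_nth)
  qed
qed

text \<open>Lowering \<open>m\<close> by one costs three degrees while a derivative gains at most
  two, so the corrections stay below the main term. \<open>loop_ser 0\<close> becomes polynomial
  only after two derivatives, which is why \<open>m\<close> is at least 2.\<close>

lemma xD_funpow_loop_ser:
  assumes "2 \<le> m" "1 \<le> j" "j \<le> m"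
  shows "\<exists>p. (xD ^^ j) (loop_ser (m - j)) = ev p \<and> degree p < 3 * m - 3"
proof (cases "j = m")
  case True
  have "xD (xD (loop_ser 0)) = ev [:-1, 1:]"
    by (simp add: xD_loop_ser_0 t_ser_eq flip: fps_const_neg)
  moreover have "(xD ^^ j) (loop_ser 0) = (xD ^^ (m - 2)) (xD (xD (loop_ser 0)))"
  proof -
    have "j = m - 2 + 2" using True assms by simp
    then have "(xD ^^ j) (loop_ser 0) = (xD ^^ (m - 2)) ((xD ^^ 2) (loop_ser 0))"
      by (metis comp_apply funpow_add)
    then show ?thesis by (simp add: numeral_2_eq_2)
  qed
  ultimately have "(xD ^^ j) (loop_ser (m - j)) = ev ((pD ^^ (m - 2)) [:-1, 1:])"
    using True xD_funpow_ev by (metis diff_self_eq_0)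
  moreover have "degree ((pD ^^ (m - 2)) [:-1, 1:]) < 3 * m - 3"
    using degree_pD_funpow_le[of "m - 2" "[:-1, 1:]"] assms by auto
  ultimately show ?thesis by blast
next
  case False
  then have "1 \<le> m - j" using assms by simp
  from loop_ser_poly[OF this] obtain w where w: "xD (loop_ser (m - j)) = ev w" "degree w = 3 * (m - j) - 1"
    by (auto simp: pos_lead_def)
  \<comment> \<open>The first derivative is split off because \<open>loop_ser 1\<close> has only a
    polynomial derivative.\<close>
  have "(xD ^^ j) (loop_ser (m - j)) = (xD ^^ (j - 1)) (xD (loop_ser (m - j)))"
    using assms by (cases j) (simp_all add: funpow_swap1)
  then have "(xD ^^ j) (loop_ser (m - j)) = ev ((pD ^^ (j - 1)) w)" by (simp add: w xD_funpow_ev)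
  moreover have "degree ((pD ^^ (j - 1)) w) < 3 * m - 3"
    using degree_pD_funpow_le[of "j - 1" w] w(2) assms False by auto
  ultimately show ?thesis by blast
qed

lemma diag_conn_ser_poly:
  assumes "2 \<le> m"
  shows "\<exists>p. degree p = 3 * m - 3 \<and> diag conn_ser m = ev p"
proof -
  obtain p0 where p0: "loop_ser m = ev p0" "pos_lead (3 * m - 3) p0" using loop_ser_poly[of m] assms by auto
  have "\<forall>j\<in>{1..m}. \<exists>p. (xD ^^ j) (loop_ser (m - j)) = ev p \<and> degree p < 3 * m - 3"
    using xD_funpow_loop_ser[OF assms] by auto
  then obtain P where P: "\<And>j. j \<in> {1..m} \<Longrightarrow> (xD ^^ j) (loop_ser (m - j)) = ev (P j)"
      "\<And>j. j \<in> {1..m} \<Longrightarrow> degree (P j) < 3 * m - 3" by metis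
  define B where "B = (\<Sum>j=1..m. smult ((- 1/2) ^ j / fact j) (P j))"
  have "degree B < 3 * m - 3"
    unfolding B_def using P(2) assms by (intro degree_sum_less) (auto intro: le_less_trans[OF degree_smult_le])
  then have "degree (p0 + B) = 3 * m - 3" using p0(2) by (simp add: degree_add_eq_left pos_lead_def)
  moreover have "diag conn_ser m = ev (p0 + B)"
  proof -
    have "diag conn_ser m = loop_ser m + (\<Sum>j=1..m. fps_const ((- 1/2) ^ j / fact j) * (xD ^^ j) (loop_ser (m - j)))"
      unfolding diag_conn_ser_eq by (simp add: atMost_atLeast0 sum.atLeast_Suc_atMost)
    also have "\<dots> = ev p0 + (\<Sum>j=1..m. ev (smult ((- 1/2) ^ j / fact j) (P j)))"
      using P(1) p0 by (simp add: ev_smult)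
    finally show ?thesis by (simp add: B_def ev_add ev_sum)
  qed
  ultimately show ?thesis by blast
qed

section \<open>The recursion in the variable \<open>w\<close>\<close>

lemma Dw_eq: "Dw f = - xD f"
  by (simp add: Dw_def xD_def)

text \<open>Here \<open>fps_X ^ m\<close> is \<open>exp (- m w)\<close>. Keeping it on both sides
  expresses the conjugated derivative of the theorem without negative powers.\<close>

lemma Dw_X_power_mult: "Dw (fps_X ^ m * f) = - (fps_X ^ m * (of_nat m * f + xD f))"
proof -
  have "xD (fps_X ^ m) = of_nat m * fps_X ^ m"
    by (rule fps_ext) (simp add: fps_X_power_iff flip: fps_of_nat)
  then show ?thesis by (simp add: Dw_eq xD_mult algebra_simps)
qed

theorem theorem5p1:
  shows "(\<forall>m::nat. Dw (fps_X ^ m * S_H (m + 1)) =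
            fps_X ^ m * (- fps_const (1/2) *
              (Dw (Dw (S_H m)) + (\<Sum>a\<le>m + 1. Dw (S_H a) * Dw (S_H (m + 1 - a))) + Dw (S_H m))))
       \<and> (\<forall>m::nat. 2 \<le> m \<longrightarrow>
            (\<exists>p :: real poly. degree p = 3 * m - 3 \<and> S_H m = poly (map_poly fps_const p) t_ser
                              \<and> poly p 1 = 0))
       \<and> (\<forall>m::nat. fps_nth (S_H m) 0 = 0)"
proof (intro conjI allI impI)
  fix m :: nat
  have "Dw (fps_X ^ m * S_H (m + 1)) = - (fps_X ^ m * (of_nat m * S_H (m + 1) + xD (S_H (m + 1))))"
    by (rule Dw_X_power_mult)
  also have "of_nat m * S_H (m + 1) + xD (S_H (m + 1)) = fps_const (1/2) *
      (xD (xD (S_H m)) - xD (S_H m) + (\<Sum>a\<le>m + 1. xD (S_H a) * xD (S_H (m + 1 - a))))"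
    using diag_rec[OF cut_join_conn_ser, of m] by (simp add: S_H_eq_diag)
  \<comment> \<open>Since \<open>Dw\<close> is \<open>- xD\<close>, the second-order and quadratic
    terms keep their signs and the first-order term changes its sign.\<close>
  finally show "Dw (fps_X ^ m * S_H (m + 1)) =
            fps_X ^ m * (- fps_const (1/2) *
              (Dw (Dw (S_H m)) + (\<Sum>a\<le>m + 1. Dw (S_H a) * Dw (S_H (m + 1 - a))) + Dw (S_H m)))"
    by (simp add: Dw_eq xD_uminus algebra_simps del: fps_const_neg sum.atMost_Suc)
next
  fix m :: nat assume "2 \<le> m"
  then obtain p where p: "degree p = 3 * m - 3" "diag conn_ser m = ev p" using diag_conn_ser_poly by blast
  \<comment> \<open>The point \<open>x = 0\<close> corresponds to \<open>t = 1\<close>, so the value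
    at 1 is the constant coefficient of the series.\<close>
  have "poly p 1 = 0" using ev_nth_0[of p] by (simp add: p(2)[symmetric] diag_def)
  with p show "\<exists>p :: real poly. degree p = 3 * m - 3 \<and> S_H m = poly (map_poly fps_const p) t_ser \<and> poly p 1 = 0"
    unfolding S_H_eq_diag ev_def by blast
next
  fix m :: nat show "fps_nth (S_H m) 0 = 0" by (simp add: S_H_eq_diag diag_def)
qed

end
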